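(* Let $\alpha,\beta\in\mathbb{R}$ be arbitrary constants, let $J,M,\Psi=J^{-1}M,\Phi=MJ^{-1},N=M\Psi$ be the operators given in the context, let $K_n=\Phi^n(2q,-2r)^T$, $n\ge0$, and let $H_n$, $n\ge0$, be Hamiltonian functions with $\frac{\delta H_n}{\delta u}=\Psi^n\frac{\delta H_0}{\delta u}$, $H_0=qr$. Then: (1) the $H_n$ are common conserved densities for all systems $u_t=K_m$, $m\ge0$, and commute with each other under the three Poisson brackets associated with $J$, $M$ and $N$: $\{H_m,H_n\}_J=\{H_m,H_n\}_M=\{H_m,H_n\}_N=0$ for all $m,n\ge0$; (2) $[K_m,K_n]=0$ for all $m,n\ge0$, so that each system $u_t=K_n$ has infinitely many commuting symmetries $K_m$, $m\ge 0$; (3) $\Phi$ is a common recursion operator for all systems $u_t=K_n$, $n\ge0$.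
   Context: Here $u=(q,r)^T$ with $q,r$ real functions of $x$ (and $t$), $\partial=\partial/\partial x$, and $\partial^{-1}$ is its skew-symmetric inverse. Concretely: all functions and components of vector functions are smooth and rapidly decreasing (Schwartz) in $x\in\mathbb{R}$, and $(\partial^{-1}f)(x)=\frac12\left(\int_{-\infty}^x f-\int_x^{\infty}f\right)$, so $\partial^{-1}\partial f=f$ for Schwartz $f$ (zero integration constants). In operator expressions, $q,r$ denote multiplication operators and juxtaposition denotes composition. Operators: $$J=\begin{pmatrix}-2\beta q\partial^{-1}q & 2+2\beta q\partial^{-1}r\\ -2+2\beta r\partial^{-1}q & -2\beta r\partial^{-1}r\end{pmatrix},\quad M=\begin{pmatrix}2\alpha q\partial^{-1}q & \partial-2\alpha q\partial^{-1}r\\ \partial-2\alpha r\partial^{-1}q & 2\alpha r\partial^{-1}r\end{pmatrix},$$ $$\Phi=MJ^{-1}=\begin{pmatrix}\frac12\partial-\alpha q\partial^{-1}r-\frac12\beta\partial q\partial^{-1}r & -\alpha q\partial^{-1}q-\frac12\beta\partial q\partial^{-1}q\\ \alpha r\partial^{-1}r-\frac12\beta\partial r\partial^{-1}r & -\frac12\partial+\alpha r\partial^{-1}q-\frac12\beta\partial r\partial^{-1}q\end{pmatrix},$$ $$\Psi=J^{-1}M=\begin{pmatrix}-\frac12\partial+\alpha r\partial^{-1}q-\frac12\beta r\partial^{-1}q\partial & -\alpha r\partial^{-1}r-\frac12\beta r\partial^{-1}r\partial\\ \alpha q\partial^{-1}q-\frac12\beta q\partial^{-1}q\partial & \frac12\partial-\alpha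 q\partial^{-1}r-\frac12\beta q\partial^{-1}r\partial\end{pmatrix},\quad N=M\Psi.$$ The systems $u_t=K_n$ form the coupled AKNS-Kaup-Newell hierarchy; $K_1=u_x$. A Hamiltonian function $H$ is a density (a function of $q,r$ and finitely many of their $x$-derivatives), representing the functional $\int H\,dx$, and $\frac{\delta H}{\delta u}=\left(\frac{\delta H}{\delta q},\frac{\delta H}{\delta r}\right)^T$ is its variational derivative. (Functions $H_n$ with the stated gradients exist for all $n\ge0$.) For $A\in\{J,M,N\}$ the bracket is $\{F,G\}_A=\int\left\langle\frac{\delta F}{\delta u},A\frac{\delta G}{\delta u}\right\rangle dx$, with $\langle\cdot,\cdot\rangle$ the standard inner product of $\mathbb{R}^2$. $H$ is a conserved density of $u_t=K$ if $\int\left\langle\frac{\delta H}{\delta u},K\right\rangle dx=0$ for all $u$. For vector fields, $[K,S]=K'[S]-S'[K]$, where $K'[S]=\frac{d}{d\varepsilon}|_{\varepsilon=0}K(u+\varepsilon S)$; $S$ is a symmetry of $u_t=K$ if $[K,S]=0$. $\Phi$ is a recursion operator for $u_t=K$ if its Lie derivative along $K$ vanishes: $L_K\Phi=\Phi'[K]-K'\Phi+\Phi K'=0$, where $\Phi'[K]=\frac{d}{d\varepsilon}|_{\varepsilon=0}\Phi(u+\varepsilon K)$ and $K'$ is the operator $S\mapsto K'[S]$. *)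

theory Defs
  imports "HOL-Analysis.Analysis"
begin

section \<open>Schwartz functions and the skew-symmetric inverse of the derivative\<close>

definition schwartz :: "(real \<Rightarrow> real) \<Rightarrow> bool" where
  "schwartz f \<longleftrightarrow>
     (\<forall>k x. (deriv ^^ k) f field_differentiable at x) \<and>
     (\<forall>m k. bounded (range (\<lambda>x. x ^ m * (deriv ^^ k) f x)))"

text \<open>The time variable plays no role in any of the notions below, so a field
  \<open>u = (q, r)\<close> is a pair of functions of \<open>x\<close> alone.\<close>

type_synonym vfun = "(real \<Rightarrow> real) \<times> (real \<Rightarrow> real)"

definition schwartz_fields :: "vfun set" where
  "schwartz_fields = {u. schwartz (fst u) \<and> schwartz (snd u)}"

definition Dinv :: "(real \<Rightarrow> real) \<Rightarrow> real \<Rightarrow> real" where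
  "Dinv f x = ((LBINT y:{..x}. f y) - (LBINT y:{x..}. f y)) / 2"


section \<open>The operators\<close>

fun opJ :: "real \<Rightarrow> vfun \<Rightarrow> vfun \<Rightarrow> vfun" where
  "opJ \<beta> (q, r) (f, g) =
    ((\<lambda>x. - 2 * \<beta> * q x * Dinv (\<lambda>y. q y * f y) x
           + (2 * g x + 2 * \<beta> * q x * Dinv (\<lambda>y. r y * g y) x)),
     (\<lambda>x. (- 2 * f x + 2 * \<beta> * r x * Dinv (\<lambda>y. q y * f y) x)
           - 2 * \<beta> * r x * Dinv (\<lambda>y. r y * g y) x))"

fun opM :: "real \<Rightarrow> vfun \<Rightarrow> vfun \<Rightarrow> vfun" where
  "opM \<alpha> (q, r) (f, g) =
    ((\<lambda>x. 2 * \<alpha> * q x * Dinv (\<lambda>y. q y * f y) x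
           + (deriv g x - 2 * \<alpha> * q x * Dinv (\<lambda>y. r y * g y) x)),
     (\<lambda>x. (deriv f x - 2 * \<alpha> * r x * Dinv (\<lambda>y. q y * f y) x)
           + 2 * \<alpha> * r x * Dinv (\<lambda>y. r y * g y) x))"

fun Phi :: "real \<Rightarrow> real \<Rightarrow> vfun \<Rightarrow> vfun \<Rightarrow> vfun" where
  "Phi \<alpha> \<beta> (q, r) (f, g) =
    ((\<lambda>x. (1/2 * deriv f x - \<alpha> * q x * Dinv (\<lambda>y. r y * f y) x
             - 1/2 * \<beta> * deriv (\<lambda>z. q z * Dinv (\<lambda>y. r y * f y) z) x)
           + (- \<alpha> * q x * Dinv (\<lambda>y. q y * g y) x
             - 1/2 * \<beta> * deriv (\<lambda>z. q z * Dinv (\<lambda>y. q y * g y) z) x)),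
     (\<lambda>x. (\<alpha> * r x * Dinv (\<lambda>y. r y * f y) x
             - 1/2 * \<beta> * deriv (\<lambda>z. r z * Dinv (\<lambda>y. r y * f y) z) x)
           + (- 1/2 * deriv g x + \<alpha> * r x * Dinv (\<lambda>y. q y * g y) x
             - 1/2 * \<beta> * deriv (\<lambda>z. r z * Dinv (\<lambda>y. q y * g y) z) x)))"

fun Psi :: "real \<Rightarrow> real \<Rightarrow> vfun \<Rightarrow> vfun \<Rightarrow> vfun" where
  "Psi \<alpha> \<beta> (q, r) (f, g) =
    ((\<lambda>x. (- 1/2 * deriv f x + \<alpha> * r x * Dinv (\<lambda>y. q y * f y) x
             - 1/2 * \<beta> * r x * Dinv (\<lambda>y. q y * deriv f y) x)
           + (- \<alpha> * r x * Dinv (\<lambda>y. r y * g y) x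
             - 1/2 * \<beta> * r x * Dinv (\<lambda>y. r y * deriv g y) x)),
     (\<lambda>x. (\<alpha> * q x * Dinv (\<lambda>y. q y * f y) x
             - 1/2 * \<beta> * q x * Dinv (\<lambda>y. q y * deriv f y) x)
           + (1/2 * deriv g x - \<alpha> * q x * Dinv (\<lambda>y. r y * g y) x
             - 1/2 * \<beta> * q x * Dinv (\<lambda>y. r y * deriv g y) x)))"

definition opN :: "real \<Rightarrow> real \<Rightarrow> vfun \<Rightarrow> vfun \<Rightarrow> vfun" where
  "opN \<alpha> \<beta> u = opM \<alpha> u \<circ> Psi \<alpha> \<beta> u"

definition Kvf :: "real \<Rightarrow> real \<Rightarrow> nat \<Rightarrow> vfun \<Rightarrow> vfun" where
  "Kvf \<alpha> \<beta> n u = (Phi \<alpha> \<beta> u ^^ n) ((\<lambda>x. 2 * fst u x), (\<lambda>x. - 2 * snd u x))"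


section \<open>Densities and variational derivatives\<close>

text \<open>The jet coordinates \<open>Qd k\<close> and \<open>Rd k\<close> stand for the \<open>k\<close>-th \<open>x\<close>-derivatives of
  \<open>q\<close> and \<open>r\<close>.\<close>

datatype jetvar = Qd nat | Rd nat

type_synonym jet = "jetvar \<Rightarrow> real"
type_synonym density = "jet \<Rightarrow> real"

fun jet_of :: "vfun \<Rightarrow> real \<Rightarrow> jet" where
  "jet_of (q, r) x (Qd k) = (deriv ^^ k) q x"
| "jet_of (q, r) x (Rd k) = (deriv ^^ k) r x"

definition jpartial :: "jetvar \<Rightarrow> density \<Rightarrow> density" where
  "jpartial v h j = deriv (\<lambda>s. h (j(v := s))) (j v)"

definition order_le :: "density \<Rightarrow> nat \<Rightarrow> bool" where
  "order_le h N \<longleftrightarrow>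
     (\<forall>j j'. (\<forall>k\<le>N. j (Qd k) = j' (Qd k) \<and> j (Rd k) = j' (Rd k)) \<longrightarrow> h j = h j')"

definition dens_order :: "density \<Rightarrow> nat" where
  "dens_order h = (LEAST N. order_le h N)"

text \<open>For a function of finitely many jet coordinates, being smooth amounts to all iterated
  partial derivatives existing and being continuous.\<close>

definition smooth_density :: "density \<Rightarrow> bool" where
  "smooth_density h \<longleftrightarrow>
     (\<forall>vs. continuous_on UNIV (foldr jpartial vs h) \<and>
           (\<forall>v j. (\<lambda>s. foldr jpartial vs h (j(v := s))) field_differentiable at (j v)))"

definition is_density :: "density \<Rightarrow> bool" where
  "is_density h \<longleftrightarrow> (\<exists>N. order_le h N) \<and> smooth_density h"

text \<open>The variational derivative of the functional with density \<open>h\<close>, given by the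
  Euler operator \<open>\<Sum>\<^sub>k (-\<partial>)\<^sup>k \<partial>h/\<partial>q\<^sup>(\<^sup>k\<^sup>)\<close> and likewise for \<open>r\<close>.\<close>

definition var_deriv :: "density \<Rightarrow> vfun \<Rightarrow> vfun" where
  "var_deriv h u =
    ((\<lambda>x. \<Sum>k\<le>dens_order h. (- 1) ^ k * (deriv ^^ k) (\<lambda>y. jpartial (Qd k) h (jet_of u y)) x),
     (\<lambda>x. \<Sum>k\<le>dens_order h. (- 1) ^ k * (deriv ^^ k) (\<lambda>y. jpartial (Rd k) h (jet_of u y)) x))"

definition pairing :: "vfun \<Rightarrow> vfun \<Rightarrow> real" where
  "pairing v w = (LBINT x. fst v x * fst w x + snd v x * snd w x)"

definition bracket :: "(vfun \<Rightarrow> vfun \<Rightarrow> vfun) \<Rightarrow> density \<Rightarrow> density \<Rightarrow> vfun \<Rightarrow> real" where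
  "bracket A F G u = pairing (var_deriv F u) (A u (var_deriv G u))"

definition conserved_density :: "density \<Rightarrow> (vfun \<Rightarrow> vfun) \<Rightarrow> bool" where
  "conserved_density h K \<longleftrightarrow> (\<forall>u\<in>schwartz_fields. pairing (var_deriv h u) (K u) = 0)"


section \<open>Vector fields, symmetries and recursion operators\<close>

text \<open>\<open>gateaux K u S\<close> is \<open>K'[S]\<close> at \<open>u\<close>, the derivative in \<open>\<epsilon>\<close> being taken at each \<open>x\<close>.\<close>

definition displace :: "vfun \<Rightarrow> real \<Rightarrow> vfun \<Rightarrow> vfun" where
  "displace u \<epsilon> S = ((\<lambda>x. fst u x + \<epsilon> * fst S x), (\<lambda>x. snd u x + \<epsilon> * snd S x))"

definition gateaux :: "(vfun \<Rightarrow> vfun) \<Rightarrow> vfun \<Rightarrow> vfun \<Rightarrow> vfun" where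
  "gateaux K u S =
    ((\<lambda>x. deriv (\<lambda>\<epsilon>. fst (K (displace u \<epsilon> S)) x) 0),
     (\<lambda>x. deriv (\<lambda>\<epsilon>. snd (K (displace u \<epsilon> S)) x) 0))"

definition vzero :: vfun where
  "vzero = ((\<lambda>x. 0), (\<lambda>x. 0))"

definition vadd :: "vfun \<Rightarrow> vfun \<Rightarrow> vfun" where
  "vadd v w = ((\<lambda>x. fst v x + fst w x), (\<lambda>x. snd v x + snd w x))"

definition vsub :: "vfun \<Rightarrow> vfun \<Rightarrow> vfun" where
  "vsub v w = ((\<lambda>x. fst v x - fst w x), (\<lambda>x. snd v x - snd w x))"

definition lie_bracket :: "(vfun \<Rightarrow> vfun) \<Rightarrow> (vfun \<Rightarrow> vfun) \<Rightarrow> vfun \<Rightarrow> vfun" where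
  "lie_bracket K S u = vsub (gateaux K u (S u)) (gateaux S u (K u))"

definition is_symmetry :: "(vfun \<Rightarrow> vfun) \<Rightarrow> (vfun \<Rightarrow> vfun) \<Rightarrow> bool" where
  "is_symmetry S K \<longleftrightarrow> (\<forall>u\<in>schwartz_fields. lie_bracket K S u = vzero)"

definition lie_deriv_op ::
    "(vfun \<Rightarrow> vfun) \<Rightarrow> (vfun \<Rightarrow> vfun \<Rightarrow> vfun) \<Rightarrow> vfun \<Rightarrow> vfun \<Rightarrow> vfun" where
  "lie_deriv_op K P u S =
     vadd (vsub (gateaux (\<lambda>w. P w S) u (K u)) (gateaux K u (P u S))) (P u (gateaux K u S))"

definition recursion_operator :: "(vfun \<Rightarrow> vfun \<Rightarrow> vfun) \<Rightarrow> (vfun \<Rightarrow> vfun) \<Rightarrow> bool" where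
  "recursion_operator P K \<longleftrightarrow>
     (\<forall>u\<in>schwartz_fields. \<forall>S\<in>schwartz_fields. lie_deriv_op K P u S = vzero)"


section \<open>The operators on Schwartz fields\<close>

lemma integrable_inverse_1_plus_sq: "integrable lborel (\<lambda>x::real. 1 / (1 + x\<^sup>2))"
proof -
  let ?f = "\<lambda>x::real. 1 / (1 + x\<^sup>2)"
  have "(\<integral>\<^sup>+x. ennreal (?f x) * indicator {0..} x \<partial>lborel) = ennreal (pi / 2 - arctan 0)"
    by (rule nn_integral_FTC_atLeast)
       (auto intro!: derivative_eq_intros tendsto_arctan_at_top simp: divide_simps not_less add_nonneg_nonneg)
  then have fin: "(\<integral>\<^sup>+x. ennreal (?f x) * indicator {0..} x \<partial>lborel) < \<infinity>" by simp
  have A: "integrable lborel (\<lambda>x. ?f x * indicator {0..} x)"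
  proof (rule integrableI_bounded)
    have "(\<integral>\<^sup>+x. ennreal (norm (?f x * indicator {0..} x)) \<partial>lborel)
        = (\<integral>\<^sup>+x. ennreal (?f x) * indicator {0..} x \<partial>lborel)"
      by (intro nn_integral_cong) (auto simp: indicator_def)
    with fin show "(\<integral>\<^sup>+x. ennreal (norm (?f x * indicator {0..} x)) \<partial>lborel) < \<infinity>" by simp
  qed simp
  have B: "integrable lborel (\<lambda>x. ?f x * indicator {0..} (- x))"
    using lborel_integrable_real_affine[OF A, of "-1" 0] by simp
  show ?thesis
    by (rule Bochner_Integration.integrable_bound[OF Bochner_Integration.integrable_add[OF A B]])
       (auto simp: indicator_def)
qed

lemma schwartz_diff: "schwartz f \<Longrightarrow> (deriv ^^ k) f field_differentiable at x"
  by (simp add: schwartz_def)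

lemma schwartz_diff0: "schwartz f \<Longrightarrow> f field_differentiable at x"
  using schwartz_diff[of f 0] by simp

lemma schwartz_cont: "schwartz f \<Longrightarrow> continuous_on S f"
  by (meson continuous_at_imp_continuous_on field_differentiable_imp_continuous_at schwartz_diff0)

lemma schwartz_integrable:
  assumes "schwartz f" shows "integrable lborel f"
proof -
  have "bounded (range (\<lambda>x. x ^ 0 * (deriv ^^ 0) f x))" "bounded (range (\<lambda>x. x ^ 2 * (deriv ^^ 0) f x))"
    using assms unfolding schwartz_def by blast+
  then obtain C D where C: "\<And>x. \<bar>f x\<bar> \<le> C" and D: "\<And>x. \<bar>x\<^sup>2 * f x\<bar> \<le> D"
    unfolding bounded_iff by auto
  have bd: "\<bar>f x\<bar> \<le> \<bar>(C + D) * (1 / (1 + x\<^sup>2))\<bar>" for x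
  proof -
    have "(1 + x\<^sup>2) * \<bar>f x\<bar> \<le> C + D"
      using C[of x] D[of x] by (simp add: abs_mult distrib_right)
    then have "\<bar>f x\<bar> \<le> (C + D) * (1 / (1 + x\<^sup>2))"
      by (simp add: field_simps add_pos_nonneg)
    then show ?thesis by linarith
  qed
  have "f \<in> borel_measurable lborel"
    using borel_measurable_continuous_onI[OF schwartz_cont[OF assms]] by simp
  then show ?thesis
    by (rule Bochner_Integration.integrable_bound
          [OF integrable_mult_right[OF integrable_inverse_1_plus_sq, of "C + D"]])
       (use bd in auto)
qed

lemma deriv_pow_Suc: "(deriv ^^ Suc k) f = (deriv ^^ k) (deriv f)"
  by (simp add: funpow_swap1)

lemma schwartz_deriv: "schwartz f \<Longrightarrow> schwartz (deriv f)"
  unfolding schwartz_def deriv_pow_Suc[symmetric] by blast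

lemma deriv_pow_add:
  assumes "\<And>k x. (deriv ^^ k) f field_differentiable at x"
    and "\<And>k x. (deriv ^^ k) g field_differentiable at x"
  shows "(deriv ^^ k) (\<lambda>x::real. f x + g x :: real) = (\<lambda>x. (deriv ^^ k) f x + (deriv ^^ k) g x)"
proof (induction k)
  case (Suc k)
  show ?case by (simp add: Suc fun_eq_iff deriv_add assms)
qed simp

lemma deriv_pow_cmult:
  assumes "\<And>k x. (deriv ^^ k) f field_differentiable at x"
  shows "(deriv ^^ k) (\<lambda>x::real. c * f x :: real) = (\<lambda>x. c * (deriv ^^ k) f x)"
proof (induction k)
  case (Suc k)
  show ?case by (simp add: Suc fun_eq_iff deriv_cmult assms)
qed simp

lemma schwartz_add:
  assumes "schwartz f" "schwartz g" shows "schwartz (\<lambda>x. f x + g x)"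
proof -
  have *: "(deriv ^^ k) (\<lambda>x. f x + g x) = (\<lambda>x. (deriv ^^ k) f x + (deriv ^^ k) g x)" for k
    by (rule deriv_pow_add) (use assms schwartz_diff in auto)
  show ?thesis
    unfolding schwartz_def * distrib_left
    using assms by (auto intro!: field_differentiable_add bounded_plus_comp simp: schwartz_def)
qed

lemma schwartz_cmult:
  assumes "schwartz f" shows "schwartz (\<lambda>x. c * f x)"
proof -
  have *: "(deriv ^^ k) (\<lambda>x. c * f x) = (\<lambda>x. c * (deriv ^^ k) f x)" for k
    by (rule deriv_pow_cmult) (use assms schwartz_diff in auto)
  have "bounded (range (\<lambda>x. x ^ m * (c * (deriv ^^ k) f x)))" for m k
  proof -
    have "bounded (range (\<lambda>x. x ^ m * (deriv ^^ k) f x))"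
      using assms by (auto simp: schwartz_def)
    then have "bounded ((\<lambda>y. c * y) ` range (\<lambda>x. x ^ m * (deriv ^^ k) f x))"
      by (rule bounded_linear_image[OF _ bounded_linear_mult_right])
    then show ?thesis by (simp add: image_image mult.left_commute)
  qed
  then show ?thesis
    unfolding schwartz_def *
    using assms by (auto intro!: derivative_intros simp: schwartz_def)
qed

lemma schwartz_uminus: "schwartz f \<Longrightarrow> schwartz (\<lambda>x. - f x)"
  using schwartz_cmult[of f "-1"] by simp

lemma schwartz_sub: "schwartz f \<Longrightarrow> schwartz g \<Longrightarrow> schwartz (\<lambda>x. f x - g x)"
  using schwartz_add[of f "\<lambda>x. - g x"] schwartz_uminus[of g] by simp

definition bsmooth :: "(real \<Rightarrow> real) \<Rightarrow> bool" where
  "bsmooth f \<longleftrightarrow> (\<forall>k x. (deriv ^^ k) f field_differentiable at x) \<and>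
     (\<forall>k. bounded (range ((deriv ^^ k) f)))"

lemma bsmooth_deriv: "bsmooth f \<Longrightarrow> bsmooth (deriv f)"
  unfolding bsmooth_def deriv_pow_Suc[symmetric] by blast

lemma bsmooth_diff0: "bsmooth f \<Longrightarrow> f field_differentiable at x"
  unfolding bsmooth_def by (metis funpow_0)

lemma schwartz_bsmooth: "schwartz f \<Longrightarrow> bsmooth f"
proof -
  assume f: "schwartz f"
  have "bounded (range ((deriv ^^ k) f))" for k
  proof -
    have "bounded (range (\<lambda>x. x ^ 0 * (deriv ^^ k) f x))"
      using f unfolding schwartz_def by blast
    then show ?thesis by simp
  qed
  then show ?thesis using f by (simp add: bsmooth_def schwartz_def)
qed

lemma schwartz_bsmooth_aux:
  assumes "\<forall>(f, b) \<in> set xs. schwartz f \<and> bsmooth b"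
  shows "\<exists>ys. (\<forall>(f, b) \<in> set ys. schwartz f \<and> bsmooth b) \<and>
     (deriv ^^ k) (\<lambda>x. \<Sum>(f, b)\<leftarrow>xs. f x * b x) = (\<lambda>x. \<Sum>(f, b)\<leftarrow>ys. f x * b x)"
proof (induction k)
  case 0
  then show ?case using assms by (intro exI[of _ xs]) auto
next
  case (Suc k)
  then obtain ys where ys: "\<forall>(f, b) \<in> set ys. schwartz f \<and> bsmooth b"
    "(deriv ^^ k) (\<lambda>x. \<Sum>(f, b)\<leftarrow>xs. f x * b x) = (\<lambda>x. \<Sum>(f, b)\<leftarrow>ys. f x * b x)" by blast
  have "\<exists>zs. (\<forall>(f, b) \<in> set zs. schwartz f \<and> bsmooth b) \<and>
     (\<forall>x. ((\<lambda>x. \<Sum>(f, b)\<leftarrow>ys. f x * b x) has_field_derivative (\<Sum>(f, b)\<leftarrow>zs. f x * b x)) (at x))"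
    using ys(1)
  proof (induction ys)
    case Nil
    then show ?case by (intro exI[of _ "[]"]) auto
  next
    case (Cons p ys)
    obtain f b where p: "p = (f, b)" by force
    from Cons obtain zs where zs: "\<forall>(f, b) \<in> set zs. schwartz f \<and> bsmooth b"
      "\<And>x. ((\<lambda>x. \<Sum>(f, b)\<leftarrow>ys. f x * b x) has_field_derivative (\<Sum>(f, b)\<leftarrow>zs. f x * b x)) (at x)"
      by auto
    have fb: "schwartz f" "bsmooth b" using Cons.prems p by auto
    have d: "(f has_field_derivative deriv f x) (at x)" "(b has_field_derivative deriv b x) (at x)" for x
      using schwartz_diff0[OF fb(1)] bsmooth_diff0[OF fb(2)]
      by (simp_all add: DERIV_deriv_iff_field_differentiable)
    have "\<forall>(f, b) \<in> set ((deriv f, b) # (f, deriv b) # zs). schwartz f \<and> bsmooth b"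
      using fb zs(1) schwartz_deriv bsmooth_deriv by simp
    moreover have "((\<lambda>x. f x * b x + (\<Sum>(f, b)\<leftarrow>ys. f x * b x)) has_field_derivative
        (deriv f x * b x + deriv b x * f x) + (\<Sum>(f, b)\<leftarrow>zs. f x * b x)) (at x)" for x
      by (intro DERIV_add DERIV_mult d zs(2))
    ultimately show ?case
      unfolding p by (intro exI[of _ "(deriv f, b) # (f, deriv b) # zs"]) (simp add: add.assoc mult.commute)
  qed
  then obtain zs where zs: "\<forall>(f, b) \<in> set zs. schwartz f \<and> bsmooth b"
     "\<And>x. ((\<lambda>x. \<Sum>(f, b)\<leftarrow>ys. f x * b x) has_field_derivative (\<Sum>(f, b)\<leftarrow>zs. f x * b x)) (at x)"
    by blast
  have "(deriv ^^ Suc k) (\<lambda>x. \<Sum>(f, b)\<leftarrow>xs. f x * b x) = (\<lambda>x. \<Sum>(f, b)\<leftarrow>zs. f x * b x)"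
    using zs(2) by (auto simp: ys(2) intro!: DERIV_imp_deriv)
  with zs(1) show ?case by blast
qed

lemma bounded_sum_list:
  assumes "\<forall>(f, b) \<in> set ys. schwartz f \<and> bsmooth b"
  shows "(\<lambda>x. \<Sum>(f, b)\<leftarrow>ys. f x * b x) field_differentiable at x"
    and "bounded (range (\<lambda>x. x ^ m * (\<Sum>(f, b)\<leftarrow>ys. f x * b x)))"
proof -
  show "(\<lambda>x. \<Sum>(f, b)\<leftarrow>ys. f x * b x) field_differentiable at x"
    using assms
  proof (induction ys)
    case (Cons p ys)
    obtain f b where p: "p = (f, b)" by force
    then have "(\<lambda>x. f x * b x) field_differentiable at x"
      using Cons.prems by (auto intro: field_differentiable_mult schwartz_diff0 bsmooth_diff0)
    then show ?case
      using Cons p field_differentiable_add by auto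
  qed auto
  show "bounded (range (\<lambda>x. x ^ m * (\<Sum>(f, b)\<leftarrow>ys. f x * b x)))"
    using assms
  proof (induction ys)
    case (Cons p ys)
    obtain f b where p: "p = (f, b)" by force
    have "bounded (range (\<lambda>x. x ^ m * (deriv ^^ 0) f x))" "bounded (range ((deriv ^^ 0) b))"
      using Cons.prems p unfolding schwartz_def bsmooth_def list.set by blast+
    then obtain C D where CD: "\<And>x. \<bar>x ^ m * f x\<bar> \<le> C" "\<And>x. \<bar>b x\<bar> \<le> D"
      unfolding bounded_iff by auto
    have "\<bar>(x ^ m * f x) * b x\<bar> \<le> C * D" for x
      unfolding abs_mult[of "x ^ m * f x"]
      using CD(1)[of x] CD(2)[of x] by (intro mult_mono) auto
    then have "bounded (range (\<lambda>x. (x ^ m * f x) * b x))"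
      unfolding bounded_iff by (intro exI[of _ "C * D"]) auto
    then show ?case
      using Cons p bounded_plus_comp[of "\<lambda>x. (x ^ m * f x) * b x" UNIV "\<lambda>x. x ^ m * (\<Sum>(f, b)\<leftarrow>ys. f x * b x)"]
      by (auto simp: distrib_left mult.assoc)
  qed (auto simp: bounded_iff)
qed

lemma schwartz_mult_bsmooth:
  assumes "schwartz f" "bsmooth b" shows "schwartz (\<lambda>x. f x * b x)"
proof -
  have *: "\<exists>ys. (\<forall>(f, b) \<in> set ys. schwartz f \<and> bsmooth b) \<and>
     (deriv ^^ k) (\<lambda>x. f x * b x) = (\<lambda>x. \<Sum>(f, b)\<leftarrow>ys. f x * b x)" for k
    using schwartz_bsmooth_aux[of "[(f, b)]" k] assms by simp
  show ?thesis
    unfolding schwartz_def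
  proof (intro conjI allI)
    fix k m x
    obtain ys where ys: "\<forall>(f, b) \<in> set ys. schwartz f \<and> bsmooth b"
      and eq: "(deriv ^^ k) (\<lambda>x. f x * b x) = (\<lambda>x. \<Sum>(f, b)\<leftarrow>ys. f x * b x)"
      using *[of k] by blast
    show "(deriv ^^ k) (\<lambda>x. f x * b x) field_differentiable at x"
      unfolding eq by (rule bounded_sum_list(1)[OF ys])
    show "bounded (range (\<lambda>x. x ^ m * (deriv ^^ k) (\<lambda>x. f x * b x) x))"
      unfolding eq by (rule bounded_sum_list(2)[OF ys])
  qed
qed

lemma schwartz_mult: "schwartz f \<Longrightarrow> schwartz g \<Longrightarrow> schwartz (\<lambda>x. f x * g x)"
  by (simp add: schwartz_mult_bsmooth schwartz_bsmooth)

lemma Dinv_eq: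
  assumes "integrable lborel f" "continuous_on UNIV f"
  shows "Dinv f x = (LBINT y:{..x}. f y) - (LBINT y. f y) / 2"
proof -
  have si: "set_integrable lborel A f" if "A \<in> sets borel" for A
    using assms(1) that unfolding set_integrable_def by (intro integrable_mult_indicator) auto
  have "(LBINT y. f y) = (LBINT y:{..x} \<union> {x<..}. f y)"
    unfolding set_lebesgue_integral_def by (intro Bochner_Integration.integral_cong) (auto simp: indicator_def)
  also have "\<dots> = (LBINT y:{..x}. f y) + (LBINT y:{x<..}. f y)"
    by (rule set_integral_Un) (auto intro: si)
  also have "(LBINT y:{x<..}. f y) = (LBINT y:{x..}. f y)"
    unfolding set_lebesgue_integral_def
    by (rule integral_cong_AE) (use assms AE_lborel_singleton[of x] in
      \<open>auto simp: indicator_def intro!: borel_measurable_integrable elim!: eventually_mono\<close>)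
  finally show ?thesis by (simp add: Dinv_def field_simps)
qed

lemma Dinv_deriv:
  assumes "integrable lborel f" "continuous_on UNIV f"
  shows "(Dinv f has_field_derivative f x) (at x)"
proof -
  have si: "set_integrable lborel A f" if "A \<in> sets borel" for A
    using assms(1) that unfolding set_integrable_def by (intro integrable_mult_indicator) auto
  define a where "a = x - 1"
  define c where "c = (LBINT y:{..<a}. f y) - (LBINT y. f y) / 2"
  have eq: "Dinv f y = c + integral {a..y} f" if "a \<le> y" for y
  proof -
    have "{..y} = {..<a} \<union> {a..y}" using that by auto
    then have "(LBINT z:{..y}. f z) = (LBINT z:{..<a}. f z) + (LBINT z:{a..y}. f z)"
      by (simp only:) (rule set_integral_Un, auto intro: si)
    then show ?thesis
      by (simp add: Dinv_eq[OF assms] c_def set_borel_integral_eq_integral(2)[OF si])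
  qed
  have "((\<lambda>y. integral {a..y} f) has_real_derivative f x) (at x within {a..x+1})"
    by (rule integral_has_real_derivative)
       (use assms(2) continuous_on_subset in \<open>auto simp: a_def\<close>)
  then have "((\<lambda>y. integral {a..y} f) has_real_derivative f x) (at x)"
    using at_within_Icc_at[of a x "x + 1"] by (simp add: a_def)
  then have "((\<lambda>y. c + integral {a..y} f) has_real_derivative f x) (at x)"
    by (auto intro!: derivative_eq_intros)
  then show ?thesis
    by (rule has_field_derivative_transform_within_open[of _ _ _ "{a<..}"])
       (auto simp: eq a_def)
qed

lemma Dinv_bsmooth:
  assumes "schwartz f" shows "bsmooth (Dinv f)"
proof -
  note fc = schwartz_integrable[OF assms] schwartz_cont[OF assms]
  have d: "deriv (Dinv f) = f" using Dinv_deriv[OF fc] by (auto intro!: DERIV_imp_deriv)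
  have "(deriv ^^ k) (Dinv f) field_differentiable at x \<and> bounded (range ((deriv ^^ k) (Dinv f)))" for k x
  proof (cases k)
    case 0
    have bd: "\<bar>LBINT y:A. f y\<bar> \<le> (LBINT y. \<bar>f y\<bar>)" if "A \<in> sets borel" for A
    proof -
      have "\<bar>LBINT y:A. f y\<bar> \<le> (LBINT y. \<bar>indicator A y *\<^sub>R f y\<bar>)"
        unfolding set_lebesgue_integral_def
        using integral_norm_bound[of lborel "\<lambda>y. indicator A y *\<^sub>R f y"] by simp
      also have "\<dots> \<le> (LBINT y. \<bar>f y\<bar>)"
        using fc(1) that by (intro integral_mono integrable_abs integrable_mult_indicator)
             (auto simp: indicator_def)
      finally show ?thesis .
    qed
    have "\<bar>Dinv f y\<bar> \<le> (LBINT y. \<bar>f y\<bar>)" for y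
      using bd[of "{..y}"] bd[of "{y..}"] unfolding Dinv_def by auto
    then have "bounded (range (Dinv f))" unfolding bounded_iff by auto
    with 0 Dinv_deriv[OF fc] show ?thesis by (auto simp: field_differentiable_def)
  next
    case (Suc k')
    have "(deriv ^^ k) (Dinv f) = (deriv ^^ k') f" unfolding Suc deriv_pow_Suc d ..
    then show ?thesis using schwartz_bsmooth[OF assms] by (auto simp: bsmooth_def)
  qed
  then show ?thesis by (auto simp: bsmooth_def)
qed

lemma Dinv_add:
  assumes "schwartz f" "schwartz g"
  shows "Dinv (\<lambda>x. f x + g x) x = Dinv f x + Dinv g x"
proof -
  have si: "set_integrable lborel A h" if "A \<in> sets borel" "schwartz h" for A h
    using schwartz_integrable[OF that(2)] that(1) unfolding set_integrable_def
    by (intro integrable_mult_indicator) auto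
  show ?thesis
    unfolding Dinv_def by (simp add: set_integral_add si assms add_divide_distrib diff_divide_distrib)
qed

lemma Dinv_cmult: "Dinv (\<lambda>x. c * f x) x = c * Dinv f x"
  unfolding Dinv_def by (simp add: right_diff_distrib)

lemma Dinv_sub:
  assumes "schwartz f" "schwartz g"
  shows "Dinv (\<lambda>x. f x - g x) x = Dinv f x - Dinv g x"
  using Dinv_add[OF assms(1) schwartz_cmult[OF assms(2), of "-1"]] Dinv_cmult[of "-1" g]
  by simp

lemma schwartz_Dinv: "schwartz f \<Longrightarrow> schwartz g \<Longrightarrow> schwartz (\<lambda>x. f x * Dinv g x)"
  by (intro schwartz_mult_bsmooth Dinv_bsmooth)

lemma schwartz_Dinv': "schwartz f \<Longrightarrow> schwartz g \<Longrightarrow> schwartz (\<lambda>x. c * f x * Dinv g x)"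
  by (intro schwartz_Dinv schwartz_cmult)

lemmas sc = schwartz_add schwartz_sub schwartz_cmult schwartz_Dinv' schwartz_Dinv
  schwartz_mult schwartz_deriv

lemma opJ_schwartz:
  assumes "u \<in> schwartz_fields" "S \<in> schwartz_fields" shows "opJ \<beta> u S \<in> schwartz_fields"
  using assms unfolding schwartz_fields_def
  by (cases u; cases S) (simp only: opJ.simps fst_conv snd_conv mem_Collect_eq, intro conjI sc; simp)

lemma opM_schwartz:
  assumes "u \<in> schwartz_fields" "S \<in> schwartz_fields" shows "opM \<alpha> u S \<in> schwartz_fields"
  using assms unfolding schwartz_fields_def
  by (cases u; cases S) (simp only: opM.simps fst_conv snd_conv mem_Collect_eq, intro conjI sc; simp)

lemma Phi_schwartz:
  assumes "u \<in> schwartz_fields" "S \<in> schwartz_fields" shows "Phi \<alpha> \<beta> u S \<in> schwartz_fields"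
  using assms unfolding schwartz_fields_def
  by (cases u; cases S) (simp only: Phi.simps fst_conv snd_conv mem_Collect_eq, intro conjI sc; simp)

lemma Psi_schwartz:
  assumes "u \<in> schwartz_fields" "S \<in> schwartz_fields" shows "Psi \<alpha> \<beta> u S \<in> schwartz_fields"
  using assms unfolding schwartz_fields_def
  by (cases u; cases S) (simp only: Psi.simps fst_conv snd_conv mem_Collect_eq, intro conjI sc; simp)

fun opJinv :: "real \<Rightarrow> vfun \<Rightarrow> vfun \<Rightarrow> vfun" where
  "opJinv \<beta> (q, r) (f, g) =
    ((\<lambda>x. - 1/2 * g x - 1/2 * \<beta> * r x * Dinv (\<lambda>y. r y * f y + q y * g y) x),
     (\<lambda>x. 1/2 * f x - 1/2 * \<beta> * q x * Dinv (\<lambda>y. r y * f y + q y * g y) x))"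

lemma opJinv_schwartz:
  assumes "u \<in> schwartz_fields" "S \<in> schwartz_fields" shows "opJinv \<beta> u S \<in> schwartz_fields"
  using assms unfolding schwartz_fields_def
  by (cases u; cases S) (simp only: opJinv.simps fst_conv snd_conv mem_Collect_eq, intro conjI sc; simp)

lemma opJ_components:
  assumes "schwartz q" "schwartz r" "schwartz f" "schwartz g"
  shows "opJ \<beta> (q, r) (f, g) =
    ((\<lambda>x. 2 * (g x - \<beta> * q x * Dinv (\<lambda>y. q y * f y - r y * g y) x)),
     (\<lambda>x. - 2 * (f x - \<beta> * r x * Dinv (\<lambda>y. q y * f y - r y * g y) x)))"
  using assms by (simp add: Dinv_sub schwartz_mult fun_eq_iff algebra_simps)

lemma opJ_opJinv:
  assumes "u \<in> schwartz_fields" "S \<in> schwartz_fields" shows "opJ \<beta> u (opJinv \<beta> u S) = S"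
proof -
  obtain q r f g where e: "u = (q, r)" "S = (f, g)" by (metis surj_pair)
  have s: "schwartz q" "schwartz r" "schwartz f" "schwartz g"
    using assms by (auto simp: e schwartz_fields_def)
  define C where "C = Dinv (\<lambda>y. r y * f y + q y * g y)"
  define a b where "a = (\<lambda>x. - 1/2 * g x - 1/2 * \<beta> * r x * C x)"
    and "b = (\<lambda>x. 1/2 * f x - 1/2 * \<beta> * q x * C x)"
  have ab: "opJinv \<beta> u S = (a, b)" by (simp add: e a_def b_def C_def)
  have "schwartz a" "schwartz b"
    using opJinv_schwartz[OF assms, of \<beta>] by (auto simp: ab schwartz_fields_def)
  note J = opJ_components[OF s(1,2) this, of \<beta>]
  have "(\<lambda>y. q y * a y - r y * b y) = (\<lambda>y. (- 1/2) * (r y * f y + q y * g y))"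
    by (simp add: a_def b_def fun_eq_iff algebra_simps)
  then have "Dinv (\<lambda>y. q y * a y - r y * b y) x = - 1/2 * C x" for x
    by (simp only: Dinv_cmult C_def)
  then show ?thesis
    unfolding ab unfolding e J by (simp add: a_def b_def fun_eq_iff algebra_simps)
qed

lemma Dinv_opJ:
  assumes "schwartz q" "schwartz r" "schwartz f" "schwartz g" "opJ \<beta> (q, r) (f, g) = (a, b)"
  shows "Dinv (\<lambda>y. r y * a y + q y * b y) x = - 2 * Dinv (\<lambda>y. q y * f y - r y * g y) x"
proof -
  have "(\<lambda>y. r y * a y + q y * b y) = (\<lambda>y. (- 2) * (q y * f y - r y * g y))"
    using opJ_components[OF assms(1-4), of \<beta>] assms(5) by (auto simp: algebra_simps)
  then show ?thesis by (simp only: Dinv_cmult)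
qed

lemma opJinv_opJ:
  assumes "u \<in> schwartz_fields" "S \<in> schwartz_fields" shows "opJinv \<beta> u (opJ \<beta> u S) = S"
proof -
  obtain q r f g where e: "u = (q, r)" "S = (f, g)" by (metis surj_pair)
  have s: "schwartz q" "schwartz r" "schwartz f" "schwartz g"
    using assms by (auto simp: e schwartz_fields_def)
  obtain a b where ab: "opJ \<beta> (q, r) (f, g) = (a, b)" by force
  note D = Dinv_opJ[OF s ab]
  show ?thesis
    using opJ_components[OF s, of \<beta>, unfolded ab]
    unfolding e ab opJinv.simps D by (simp add: fun_eq_iff field_simps)
qed

text \<open>\<open>opJ\<close> is invertible on Schwartz fields, and the explicit matrices for \<open>Psi\<close> and \<open>Phi\<close>
  are \<open>J\<^sup>-\<^sup>1 M\<close> and \<open>M J\<^sup>-\<^sup>1\<close>.\<close>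

lemma bij_betw_opJ:
  assumes "u \<in> schwartz_fields"
  shows "bij_betw (opJ \<beta> u) schwartz_fields schwartz_fields"
  by (rule bij_betw_byWitness[where f' = "opJinv \<beta> u"])
     (use assms in \<open>auto simp: opJ_opJinv opJinv_opJ opJ_schwartz opJinv_schwartz\<close>)

lemma opJ_Psi:
  assumes "u \<in> schwartz_fields" "S \<in> schwartz_fields"
  shows "opJ \<beta> u (Psi \<alpha> \<beta> u S) = opM \<alpha> u S"
proof -
  obtain q r f g where e: "u = (q, r)" "S = (f, g)" by (metis surj_pair)
  have s: "schwartz q" "schwartz r" "schwartz f" "schwartz g"
    using assms by (auto simp: e schwartz_fields_def)
  obtain a b where ab: "Psi \<alpha> \<beta> (q, r) (f, g) = (a, b)" by force
  have "schwartz a" "schwartz b"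
    using Psi_schwartz[OF assms, of \<alpha> \<beta>] unfolding e ab schwartz_fields_def by auto
  note J = opJ_components[OF s(1,2) this, of \<beta>]
  define T where "T = (\<lambda>x. \<alpha> * (Dinv (\<lambda>y. q y * f y) x - Dinv (\<lambda>y. r y * g y) x)
    - 1/2 * \<beta> * (Dinv (\<lambda>y. q y * deriv f y) x + Dinv (\<lambda>y. r y * deriv g y) x))"
  have T: "a = (\<lambda>x. - 1/2 * deriv f x + r x * T x)" "b = (\<lambda>x. 1/2 * deriv g x + q x * T x)"
    using ab by (auto simp: T_def fun_eq_iff algebra_simps)
  have "(\<lambda>y. q y * a y - r y * b y) = (\<lambda>y. (- 1/2) * (q y * deriv f y + r y * deriv g y))"
    unfolding T by (simp add: fun_eq_iff algebra_simps)
  then have D: "Dinv (\<lambda>y. q y * a y - r y * b y) x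
      = - 1/2 * (Dinv (\<lambda>y. q y * deriv f y) x + Dinv (\<lambda>y. r y * deriv g y) x)" for x
    by (simp only: Dinv_cmult Dinv_add schwartz_mult schwartz_deriv s)
  then show ?thesis
    unfolding e ab J D opM.simps unfolding T T_def by (simp add: fun_eq_iff algebra_simps)
qed

lemma Phi_opJ:
  assumes "u \<in> schwartz_fields" "S \<in> schwartz_fields"
  shows "Phi \<alpha> \<beta> u (opJ \<beta> u S) = opM \<alpha> u S"
proof -
  obtain q r f g where e: "u = (q, r)" "S = (f, g)" by (metis surj_pair)
  have s: "schwartz q" "schwartz r" "schwartz f" "schwartz g"
    using assms by (auto simp: e schwartz_fields_def)
  obtain a b where ab: "opJ \<beta> (q, r) (f, g) = (a, b)" by force
  have sab: "schwartz a" "schwartz b"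
    using opJ_schwartz[OF assms, of \<beta>] unfolding e ab schwartz_fields_def by auto
  define E where "E = Dinv (\<lambda>y. q y * f y - r y * g y)"
  have C: "Dinv (\<lambda>y. r y * a y) x + Dinv (\<lambda>y. q y * b y) x = - 2 * E x" for x
    using Dinv_opJ[OF s ab, of x] s sab by (simp add: Dinv_add schwartz_mult E_def)
  have M: "Dinv (\<lambda>y. q y * f y) x - Dinv (\<lambda>y. r y * g y) x = E x" for x
    using s by (simp add: Dinv_sub schwartz_mult E_def)
  have sE: "schwartz (\<lambda>x. p x * E x)" if "schwartz p" for p
    unfolding E_def by (intro sc that s)
  have fd: "(\<lambda>x. p x * E x) field_differentiable at x" "(\<lambda>x. c * (p x * E x)) field_differentiable at x"
    if "schwartz p" for p x c
    using schwartz_diff0[OF sE[OF that]] schwartz_diff0[OF schwartz_cmult[OF sE[OF that]]] by blast+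
  have dC: "deriv (\<lambda>z. p z * Dinv (\<lambda>y. r y * a y) z) x + deriv (\<lambda>z. p z * Dinv (\<lambda>y. q y * b y) z) x
      = - 2 * deriv (\<lambda>z. p z * E z) x" if p: "schwartz p" for p x
  proof -
    have "deriv (\<lambda>z. p z * Dinv (\<lambda>y. r y * a y) z) x + deriv (\<lambda>z. p z * Dinv (\<lambda>y. q y * b y) z) x
        = deriv (\<lambda>z. p z * Dinv (\<lambda>y. r y * a y) z + p z * Dinv (\<lambda>y. q y * b y) z) x"
      by (rule deriv_add[symmetric]) (intro schwartz_diff0 sc p s sab)+
    also have "(\<lambda>z. p z * Dinv (\<lambda>y. r y * a y) z + p z * Dinv (\<lambda>y. q y * b y) z) = (\<lambda>z. - 2 * (p z * E z))"
      by (simp add: fun_eq_iff C distrib_left[symmetric])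
    also have "deriv \<dots> x = - 2 * deriv (\<lambda>z. p z * E z) x"
      by (rule deriv_cmult) (rule fd(1)[OF p])
    finally show ?thesis .
  qed
  have "a = (\<lambda>x. 2 * g x - 2 * \<beta> * (q x * E x))" "b = (\<lambda>x. - 2 * f x + 2 * \<beta> * (r x * E x))"
    using opJ_components[OF s, of \<beta>] ab by (auto simp: E_def algebra_simps)
  then have d: "deriv a x = 2 * deriv g x - 2 * \<beta> * deriv (\<lambda>x. q x * E x) x"
    "deriv b x = - 2 * deriv f x + 2 * \<beta> * deriv (\<lambda>x. r x * E x) x" for x
    by (simp_all only: deriv_diff deriv_add deriv_cmult fd schwartz_diff0 schwartz_cmult s)
  have 1: "1/2 * deriv a x - \<alpha> * q x * A - 1/2 * \<beta> * A' + (- \<alpha> * q x * B - 1/2 * \<beta> * B')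
      = 2 * \<alpha> * q x * P + (deriv g x - 2 * \<alpha> * q x * Q)"
    if "A + B = - 2 * E x" "A' + B' = - 2 * deriv (\<lambda>z. q z * E z) x" "P - Q = E x" for x A B A' B' P Q
  proof -
    have "1/2 * deriv a x - \<alpha> * q x * A - 1/2 * \<beta> * A' + (- \<alpha> * q x * B - 1/2 * \<beta> * B')
      = 1/2 * deriv a x - \<alpha> * q x * (A + B) - 1/2 * \<beta> * (A' + B')" by (simp add: algebra_simps)
    also have "\<dots> = deriv g x + 2 * \<alpha> * q x * (P - Q)" unfolding that d by (simp add: algebra_simps)
    finally show ?thesis by (simp add: algebra_simps)
  qed
  have 2: "\<alpha> * r x * A - 1/2 * \<beta> * A' + (- 1/2 * deriv b x + \<alpha> * r x * B - 1/2 * \<beta> * B')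
      = deriv f x - 2 * \<alpha> * r x * P + 2 * \<alpha> * r x * Q"
    if "A + B = - 2 * E x" "A' + B' = - 2 * deriv (\<lambda>z. r z * E z) x" "P - Q = E x" for x A B A' B' P Q
  proof -
    have "\<alpha> * r x * A - 1/2 * \<beta> * A' + (- 1/2 * deriv b x + \<alpha> * r x * B - 1/2 * \<beta> * B')
      = - 1/2 * deriv b x + \<alpha> * r x * (A + B) - 1/2 * \<beta> * (A' + B')" by (simp add: algebra_simps)
    also have "\<dots> = deriv f x - 2 * \<alpha> * r x * (P - Q)" unfolding that d by (simp add: algebra_simps)
    finally show ?thesis by (simp add: algebra_simps)
  qed
  show ?thesis
    unfolding e ab Phi.simps opM.simps prod.inject fun_eq_iff
    by (intro conjI allI 1 2 C dC M s)
qed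

lemma Psi_eq:
  assumes "u \<in> schwartz_fields" "S \<in> schwartz_fields"
  shows "Psi \<alpha> \<beta> u S = inv_into schwartz_fields (opJ \<beta> u) (opM \<alpha> u S)"
  using bij_betw_inv_into_left[OF bij_betw_opJ[OF assms(1)] Psi_schwartz[OF assms]]
  by (metis opJ_Psi[OF assms])

lemma Phi_eq:
  assumes "u \<in> schwartz_fields" "S \<in> schwartz_fields"
  shows "Phi \<alpha> \<beta> u S = opM \<alpha> u (inv_into schwartz_fields (opJ \<beta> u) S)"
  using bij_betw_inv_into_right[OF bij_betw_opJ[OF assms(1)] assms(2)]
        Phi_opJ[OF assms(1) inv_into_into] bij_betw_opJ[OF assms(1)] assms(2)
  by (metis bij_betw_imp_surj_on)

lemma Kvf_schwartz: "u \<in> schwartz_fields \<Longrightarrow> Kvf \<alpha> \<beta> n u \<in> schwartz_fields"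
proof (induction n)
  case 0
  then show ?case unfolding Kvf_def schwartz_fields_def
    using schwartz_cmult[of "fst u" 2] schwartz_cmult[of "snd u" "-2"] by auto
next
  case (Suc n)
  then show ?case using Phi_schwartz by (simp add: Kvf_def)
qed

lemma pairing_integrable:
  assumes "v \<in> schwartz_fields" "w \<in> schwartz_fields"
  shows "integrable lborel (\<lambda>x. fst v x * fst w x + snd v x * snd w x)"
  using assms unfolding schwartz_fields_def by (auto intro!: schwartz_integrable schwartz_add schwartz_mult)

lemma var_deriv_qr:
  "var_deriv (\<lambda>j. j (Qd 0) * j (Rd 0)) u = (snd u, fst u)"
proof -
  let ?h = "\<lambda>j::jet. j (Qd 0) * j (Rd 0)"
  have "order_le ?h 0" by (simp add: order_le_def)
  then have o: "dens_order ?h = 0" unfolding dens_order_def by (metis Least_le le_zero_eq)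
  obtain q r where u: "u = (q, r)" by force
  have "deriv (\<lambda>s. s * c) x = c" "deriv (\<lambda>s. c * s) x = c" for c x :: real
    by (auto intro!: DERIV_imp_deriv derivative_eq_intros)
  then show ?thesis by (simp add: var_deriv_def o jpartial_def u)
qed


end

theory Submission
  imports Defs "HOL-Computational_Algebra.Polynomial"
begin

text \<open>Since \<open>J\<close> and \<open>M = J \<Psi>\<close> are skew, the pairing of \<open>\<Psi>\<^sup>m \<gamma>\<close> with \<open>J \<Psi>\<^sup>n \<gamma>\<close>, where
  \<open>\<gamma> = (r, q)\<close>, depends only on \<open>m + n\<close> and is antisymmetric in \<open>m, n\<close>, hence zero; and
  \<open>K\<^sub>n = J \<Psi>\<^sup>n \<gamma>\<close>.  For the rest, \<open>\<Phi> v = \<sigma> v\<^sub>x / 2 - L (u \<partial>\<^sup>-\<^sup>1 \<rho>(u, v))\<close> with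
  \<open>\<sigma> = diag (1, -1)\<close>, \<open>L = \<alpha> \<sigma> + \<beta> \<partial> / 2\<close> and \<open>\<rho>(u, v) = r v\<^sub>1 + q v\<^sub>2\<close>.  The Nijenhuis torsion of \<open>\<Phi>\<close>
  vanishes, so the Lie derivative of \<open>\<Phi>\<close> along \<open>\<Phi> K\<close> is \<open>\<Phi>\<close> applied to the one along \<open>K\<close>, and
  it is zero along \<open>K\<^sub>0\<close>; then \<open>[K\<^sub>m, \<Phi> K\<^sub>n] = \<Phi> [K\<^sub>m, K\<^sub>n]\<close>.  The Gateaux derivatives can be
  taken termwise because every field involved is polynomial in \<open>\<epsilon>\<close> along \<open>u + \<epsilon> S\<close>.  The
  \<open>K\<^sub>n\<close> are distinct because their linearizations at \<open>u = 0\<close> are multiples of \<open>\<partial>\<^sup>n\<close>, which map the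
  Gaussian to itself times polynomials of different degrees.\<close>

section \<open>The inverse derivative at infinity\<close>

lemma Dinv_tendsto_at_top:
  assumes "integrable lborel f" "continuous_on UNIV f"
  shows "(Dinv f \<longlongrightarrow> (LBINT y. f y) / 2) at_top"
proof -
  have "((\<lambda>x. (LBINT y:{..x}. f y) - (LBINT y. f y) / 2)
          \<longlongrightarrow> (LBINT y. f y) - (LBINT y. f y) / 2) at_top"
    unfolding set_lebesgue_integral_def
    by (intro tendsto_intros tendsto_integral_at_top assms) simp
  moreover have "Dinv f = (\<lambda>x. (LBINT y:{..x}. f y) - (LBINT y. f y) / 2)"
    by (intro ext Dinv_eq assms)
  ultimately show ?thesis by simp
qed

text \<open>The substitution y -> -y swaps the two half-lines, so the limit at minus infinity
  follows from the one at plus infinity.\<close>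

lemma Dinv_reflect: "Dinv f (- x) = - Dinv (\<lambda>y. f (- y)) x"
proof -
  have 1: "(LBINT y:{..- x}. f y) = (LBINT y:{x..}. f (- y))"
    unfolding set_lebesgue_integral_def
    by (subst lborel_integral_real_affine[of "-1" _ 0])
       (auto intro!: Bochner_Integration.integral_cong simp: indicator_def)
  have 2: "(LBINT y:{- x..}. f y) = (LBINT y:{..x}. f (- y))"
    unfolding set_lebesgue_integral_def
    by (subst lborel_integral_real_affine[of "-1" _ 0])
       (auto intro!: Bochner_Integration.integral_cong simp: indicator_def)
  show ?thesis unfolding Dinv_def 1 2 by (simp add: field_simps)
qed

lemma Dinv_tendsto_at_bot:
  assumes "integrable lborel f" "continuous_on UNIV f"
  shows "(Dinv f \<longlongrightarrow> - (LBINT y. f y) / 2) at_bot"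
proof -
  have i: "integrable lborel (\<lambda>y. f (- y))"
    using lborel_integrable_real_affine[OF assms(1), of "-1" 0] by simp
  have c: "continuous_on UNIV (\<lambda>y. f (- y))"
    by (intro continuous_on_compose2[OF assms(2)] continuous_intros) auto
  have e: "(LBINT y. f (- y)) = (LBINT y. f y)"
    using lborel_integral_real_affine[of "-1" f 0] by simp
  show ?thesis
    unfolding filterlim_at_bot_mirror Dinv_reflect
    using tendsto_minus[OF Dinv_tendsto_at_top[OF i c]] by (simp add: e)
qed

text \<open>\<open>F\<close> and \<open>Dinv h\<close> differ by a constant, and
  \<open>Dinv h\<close> tends to plus and minus half the integral of \<open>h\<close> at the two
  ends. Comparing limits determines both the integral and the constant.\<close>

lemma antiderivative_limits:
  assumes "schwartz h" "\<And>x. (F has_real_derivative h x) (at x)"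
    and "(F \<longlongrightarrow> A) at_top" "(F \<longlongrightarrow> B) at_bot"
  shows "(LBINT y. h y) = A - B" "Dinv h x = F x - (A + B) / 2"
proof -
  note ic = schwartz_integrable[OF assms(1)] schwartz_cont[OF assms(1)]
  define c where "c = F 0 - Dinv h 0"
  have "((\<lambda>x. F x - Dinv h x) has_real_derivative 0) (at x)" for x
    using DERIV_diff[OF assms(2) Dinv_deriv[OF ic]] by simp
  then have "F x - Dinv h x = F 0 - Dinv h 0" for x
    using DERIV_isconst_all by blast
  then have F: "F x = c + Dinv h x" for x
    unfolding c_def by (metis diff_add_cancel)
  have "(F \<longlongrightarrow> c + (LBINT y. h y) / 2) at_top" "(F \<longlongrightarrow> c + (- (LBINT y. h y) / 2)) at_bot"
    unfolding F by (intro tendsto_intros Dinv_tendsto_at_top Dinv_tendsto_at_bot ic)+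
  then have "A = c + (LBINT y. h y) / 2" "B = c + (- (LBINT y. h y) / 2)"
    using assms(3,4) tendsto_unique trivial_limit_at_top_linorder trivial_limit_at_bot_linorder by blast+
  then show "(LBINT y. h y) = A - B" "Dinv h x = F x - (A + B) / 2"
    using F by (auto simp: field_simps)
qed

lemma schwartz_has_deriv: "schwartz f \<Longrightarrow> (f has_real_derivative deriv f x) (at x)"
  by (simp add: DERIV_deriv_iff_field_differentiable schwartz_diff0)

lemma schwartz_Dinv_has_deriv: "schwartz f \<Longrightarrow> (Dinv f has_real_derivative f x) (at x)"
  by (intro Dinv_deriv schwartz_integrable schwartz_cont)

lemma schwartz_tendsto_0:
  assumes "schwartz f"
  shows "(f \<longlongrightarrow> 0) at_top" "(f \<longlongrightarrow> 0) at_bot"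
proof -
  \<comment> \<open>Boundedness of x f(x) alone already gives decay like C / |x|.\<close>
  have "bounded (range (\<lambda>x. x ^ 1 * (deriv ^^ 0) f x))"
    using assms unfolding schwartz_def by blast
  then obtain C where C: "\<And>x. \<bar>x * f x\<bar> \<le> C" unfolding bounded_iff by auto
  have bd: "norm (f x) \<le> C * inverse \<bar>x\<bar>" if "x \<noteq> 0" for x
    using C[of x] that by (simp add: abs_mult field_simps)
  have "((\<lambda>x::real. C * inverse \<bar>x\<bar>) \<longlongrightarrow> C * 0) at_top"
    by (intro tendsto_intros tendsto_inverse_0_at_top filterlim_abs_real)
  then have "((\<lambda>x::real. C * inverse \<bar>x\<bar>) \<longlongrightarrow> 0) at_top" by (simp only: mult_zero_right)
  moreover have "\<forall>\<^sub>F x in at_top. norm (f x) \<le> C * inverse \<bar>x\<bar>"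
    using eventually_at_top_not_equal[of 0] by eventually_elim (rule bd)
  ultimately show "(f \<longlongrightarrow> 0) at_top"
    by (rule Lim_null_comparison[rotated])
  have "((\<lambda>x::real. C * inverse \<bar>x\<bar>) \<longlongrightarrow> C * 0) at_bot"
    unfolding filterlim_at_bot_mirror abs_minus
    by (intro tendsto_intros tendsto_inverse_0_at_top filterlim_abs_real)
  then have "((\<lambda>x::real. C * inverse \<bar>x\<bar>) \<longlongrightarrow> 0) at_bot" by (simp only: mult_zero_right)
  moreover have "\<forall>\<^sub>F x in at_bot. norm (f x) \<le> C * inverse \<bar>x\<bar>"
    using eventually_at_bot_not_equal[of 0] by eventually_elim (rule bd)
  ultimately show "(f \<longlongrightarrow> 0) at_bot"
    by (rule Lim_null_comparison[rotated])
qed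

lemma integral_deriv_schwartz: "schwartz f \<Longrightarrow> (LBINT x. deriv f x) = 0"
  using antiderivative_limits(1)[OF schwartz_deriv schwartz_has_deriv schwartz_tendsto_0, of f] by simp

lemma Dinv_deriv_schwartz: "schwartz f \<Longrightarrow> Dinv (deriv f) x = f x"
  using antiderivative_limits(2)[OF schwartz_deriv schwartz_has_deriv schwartz_tendsto_0, of f] by simp

text \<open>The integrand is the derivative of \<open>Dinv f * Dinv g\<close>. Both factors change
  sign between the limits at the two ends, so the product has the same limit at both.\<close>

lemma Dinv_skew:
  assumes "schwartz f" "schwartz g"
  shows "(LBINT x. f x * Dinv g x + g x * Dinv f x) = 0"
proof -
  note ic = schwartz_integrable[OF assms(1)] schwartz_cont[OF assms(1)]
  note ic' = schwartz_integrable[OF assms(2)] schwartz_cont[OF assms(2)]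
  let ?A = "(LBINT y. f y) / 2" and ?B = "(LBINT y. g y) / 2"
  have "(LBINT x. f x * Dinv g x + g x * Dinv f x)
      = ?A * ?B - (- (LBINT y. f y) / 2) * (- (LBINT y. g y) / 2)"
  proof (rule antiderivative_limits(1)[where F = "\<lambda>x. Dinv f x * Dinv g x"])
    show "schwartz (\<lambda>x. f x * Dinv g x + g x * Dinv f x)" by (intro sc assms)
    show "((\<lambda>x. Dinv f x * Dinv g x) has_real_derivative f x * Dinv g x + g x * Dinv f x) (at x)" for x
      by (rule DERIV_mult[OF schwartz_Dinv_has_deriv[OF assms(1)] schwartz_Dinv_has_deriv[OF assms(2)]])
  qed (intro tendsto_mult Dinv_tendsto_at_top Dinv_tendsto_at_bot ic ic')+
  then show ?thesis by simp
qed

section \<open>Conserved densities and Poisson brackets\<close>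

lemma opM_components:
  assumes "schwartz q" "schwartz r" "schwartz f" "schwartz g"
  shows "opM \<alpha> (q, r) (f, g) =
    ((\<lambda>x. deriv g x + 2 * \<alpha> * q x * Dinv (\<lambda>y. q y * f y - r y * g y) x),
     (\<lambda>x. deriv f x - 2 * \<alpha> * r x * Dinv (\<lambda>y. q y * f y - r y * g y) x))"
  using assms by (simp add: Dinv_sub schwartz_mult fun_eq_iff algebra_simps)

lemma pairing_add_pairing:
  assumes "v \<in> schwartz_fields" "w \<in> schwartz_fields" "v' \<in> schwartz_fields" "w' \<in> schwartz_fields"
  shows "pairing v w + pairing v' w'
    = (LBINT x. (fst v x * fst w x + snd v x * snd w x) + (fst v' x * fst w' x + snd v' x * snd w' x))"
  unfolding pairing_def
  by (rule Bochner_Integration.integral_add[symmetric]) (intro pairing_integrable assms)+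

text \<open>In the sum of the two pairings the local terms cancel pointwise. The nonlocal ones see
  the fields only through the sources \<open>a\<close> and \<open>b\<close> and form the integrand
  of \<open>Dinv_skew\<close>.\<close>

lemma opJ_skew:
  assumes u: "u \<in> schwartz_fields" and v: "v \<in> schwartz_fields" and w: "w \<in> schwartz_fields"
  shows "pairing v (opJ \<beta> u w) = - pairing w (opJ \<beta> u v)"
proof -
  obtain q r f g h k where e: "u = (q, r)" "w = (f, g)" "v = (h, k)" by (metis surj_pair)
  have s: "schwartz q" "schwartz r" "schwartz f" "schwartz g" "schwartz h" "schwartz k"
    using assms by (auto simp: e schwartz_fields_def)
  define a where "a = (\<lambda>y. q y * f y - r y * g y)"
  define b where "b = (\<lambda>y. q y * h y - r y * k y)"
  have ab: "schwartz a" "schwartz b" unfolding a_def b_def by (intro sc s)+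
  have "pairing v (opJ \<beta> u w) + pairing w (opJ \<beta> u v)
      = (LBINT x. (- 2 * \<beta>) * (b x * Dinv a x + a x * Dinv b x))"
    unfolding pairing_add_pairing[OF v opJ_schwartz[OF u w] w opJ_schwartz[OF u v]]
    unfolding e opJ_components[OF s(1-4)] opJ_components[OF s(1,2,5,6)]
      a_def[symmetric] b_def[symmetric]
    by (rule Bochner_Integration.integral_cong) (simp_all add: a_def b_def algebra_simps)
  also have "\<dots> = 0" using Dinv_skew[OF ab(2,1)] by simp
  finally show ?thesis by simp
qed

lemma opM_skew:
  assumes u: "u \<in> schwartz_fields" and v: "v \<in> schwartz_fields" and w: "w \<in> schwartz_fields"
  shows "pairing v (opM \<alpha> u w) = - pairing w (opM \<alpha> u v)"
proof -
  obtain q r f g h k where e: "u = (q, r)" "w = (f, g)" "v = (h, k)" by (metis surj_pair)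
  have s: "schwartz q" "schwartz r" "schwartz f" "schwartz g" "schwartz h" "schwartz k"
    using assms by (auto simp: e schwartz_fields_def)
  define a where "a = (\<lambda>y. q y * f y - r y * g y)"
  define b where "b = (\<lambda>y. q y * h y - r y * k y)"
  have ab: "schwartz a" "schwartz b" unfolding a_def b_def by (intro sc s)+
  \<comment> \<open>Here the local terms do not cancel: they add up to the derivative of
    \<open>P\<close>, whose integral is zero.\<close>
  define P where "P = (\<lambda>x. h x * g x + k x * f x)"
  have P: "schwartz P" unfolding P_def by (intro sc s)
  have dP: "deriv P x = (deriv h x * g x + deriv g x * h x) + (deriv k x * f x + deriv f x * k x)" for x
    unfolding P_def by (intro DERIV_imp_deriv DERIV_add DERIV_mult schwartz_has_deriv s)
  have "pairing v (opM \<alpha> u w) + pairing w (opM \<alpha> u v)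
      = (LBINT x. deriv P x + (2 * \<alpha>) * (b x * Dinv a x + a x * Dinv b x))"
    unfolding pairing_add_pairing[OF v opM_schwartz[OF u w] w opM_schwartz[OF u v]]
    unfolding e opM_components[OF s(1-4)] opM_components[OF s(1,2,5,6)]
      a_def[symmetric] b_def[symmetric] dP
    by (rule Bochner_Integration.integral_cong) (simp_all add: a_def b_def algebra_simps)
  also have "\<dots> = (LBINT x. deriv P x) + (LBINT x. (2 * \<alpha>) * (b x * Dinv a x + a x * Dinv b x))"
    by (intro Bochner_Integration.integral_add schwartz_integrable sc P ab)
  also have "\<dots> = 0" using Dinv_skew[OF ab(2,1)] integral_deriv_schwartz[OF P] by simp
  finally show ?thesis by simp
qed

section \<open>The Lenard chain of gradients\<close>

context
  fixes \<alpha> \<beta> :: real and u :: vfun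
  assumes u: "u \<in> schwartz_fields"
begin

text \<open>In the final theorem this is the variational derivative of \<open>H n\<close>; the pair
  \<open>(snd u, fst u)\<close> is that of q r.\<close>

abbreviation (input) "gamma n \<equiv> (Psi \<alpha> \<beta> u ^^ n) (snd u, fst u)"

lemma grad_schwartz: "gamma n \<in> schwartz_fields"
  using u by (induction n) (auto intro!: Psi_schwartz, simp add: schwartz_fields_def)

text \<open>The Lenard relation: \<open>M\<close> applied to one gradient is \<open>J\<close>
  applied to the next. It turns every \<open>M\<close> pairing into a \<open>J\<close> pairing with
  one index raised.\<close>

lemma opJ_grad_Suc: "opJ \<beta> u (gamma (Suc n)) = opM \<alpha> u (gamma n)"
  using opJ_Psi[OF u grad_schwartz] by simp

lemma pairing_opJ_grad: "pairing (gamma m) (opJ \<beta> u (gamma n)) = 0"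
proof -
  let ?a = "\<lambda>m n. pairing (gamma m) (opJ \<beta> u (gamma n))"
  have skew: "?a m n = - ?a n m" for m n by (intro opJ_skew u grad_schwartz)
  \<comment> \<open>Skewness is used once for \<open>M\<close> and once for \<open>J\<close>; the
    two signs cancel, so a unit of index moves across freely.\<close>
  have shift: "?a m (Suc n) = ?a (Suc m) n" for m n
  proof -
    have "?a m (Suc n) = pairing (gamma m) (opM \<alpha> u (gamma n))" by (simp only: opJ_grad_Suc)
    also have "\<dots> = - pairing (gamma n) (opM \<alpha> u (gamma m))" by (intro opM_skew u grad_schwartz)
    also have "\<dots> = - ?a n (Suc m)" by (simp only: opJ_grad_Suc)
    also have "\<dots> = ?a (Suc m) n" using skew[of n "Suc m"] by linarith
    finally show ?thesis .
  qed
  \<comment> \<open>Moving all of \<open>m\<close> across shows that the value depends on m + n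
    only. It is then symmetric in m and n, while \<open>skew\<close> makes it antisymmetric.\<close>
  have zero_first: "?a m n = ?a 0 (m + n)" for m n
    by (induction m arbitrary: n) (metis add_0, metis shift add_Suc_shift)
  have "?a m n = ?a n m" using zero_first[of m n] zero_first[of n m] by (simp only: add.commute)
  with skew[of m n] show ?thesis by linarith
qed

text \<open>Since Phi J = M = J Psi, \<open>Phi\<close> carries the image under \<open>J\<close> of
  one gradient to that of the next.\<close>

lemma Kvf_eq_opJ_grad: "Kvf \<alpha> \<beta> n u = opJ \<beta> u (gamma n)"
proof (induction n)
  case 0
  obtain q r where e: "u = (q, r)" by force
  have "schwartz q" "schwartz r" using u by (auto simp: e schwartz_fields_def)
  \<comment> \<open>At the gradient (r, q) both nonlocal terms of \<open>J\<close> are built on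
    \<open>Dinv\<close> of q r and cancel, which leaves (2q, -2r).\<close>
  then show ?case
    by (simp add: Kvf_def e mult.commute)
next
  case (Suc n)
  have "Kvf \<alpha> \<beta> (Suc n) u = Phi \<alpha> \<beta> u (opJ \<beta> u (gamma n))"
    using Suc by (simp add: Kvf_def)
  also have "\<dots> = opJ \<beta> u (gamma (Suc n))"
    unfolding Phi_opJ[OF u grad_schwartz] opJ_grad_Suc ..
  finally show ?case .
qed

end

section \<open>Polynomial curves of Schwartz functions\<close>

text \<open>Polynomials in e with Schwartz functions as coefficients, in Horner form.
  Differentiating such a curve at e = 0 needs only linearity in the coefficients and never exchanges
  a limit with the integral inside \<open>Dinv\<close>.\<close>

inductive poly_curve :: "(real \<Rightarrow> real \<Rightarrow> real) \<Rightarrow> bool" where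
  poly_curve_const: "schwartz c \<Longrightarrow> poly_curve (\<lambda>e. c)"
| poly_curve_step: "schwartz c \<Longrightarrow> poly_curve F \<Longrightarrow> poly_curve (\<lambda>e x. c x + e * F e x)"

definition velocity :: "(real \<Rightarrow> real \<Rightarrow> real) \<Rightarrow> real \<Rightarrow> real" where
  "velocity F x = deriv (\<lambda>e. F e x) 0"

lemma schwartz_zero: "schwartz (\<lambda>x. 0)"
proof -
  have "(deriv ^^ k) (\<lambda>x::real. 0::real) = (\<lambda>x. 0)" for k
    by (induction k) auto
  then show ?thesis unfolding schwartz_def by (auto simp: bounded_iff)
qed

lemma poly_curve_schwartz: "poly_curve F \<Longrightarrow> schwartz (F e)"
  by (induction rule: poly_curve.induct) (auto intro: schwartz_add schwartz_cmult)

lemma poly_curve_differentiable: "poly_curve F \<Longrightarrow> (\<lambda>e. F e x) field_differentiable at e"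
  by (induction rule: poly_curve.induct) (auto intro!: derivative_intros)

lemma poly_curve_has_velocity:
  "poly_curve F \<Longrightarrow> ((\<lambda>e. F e x) has_real_derivative velocity F x) (at 0)"
  by (simp add: velocity_def DERIV_deriv_iff_field_differentiable poly_curve_differentiable)

lemma velocity_const: "velocity (\<lambda>e. c) = (\<lambda>x. 0)"
  by (simp add: velocity_def fun_eq_iff)

lemma velocity_step: "poly_curve F \<Longrightarrow> velocity (\<lambda>e x. c x + e * F e x) = F 0"
  unfolding velocity_def[abs_def]
  by (auto intro!: ext DERIV_imp_deriv derivative_eq_intros poly_curve_has_velocity)

lemma velocity_schwartz: "poly_curve F \<Longrightarrow> schwartz (velocity F)"
  by (induction rule: poly_curve.induct)
     (simp_all add: velocity_const schwartz_zero velocity_step poly_curve_schwartz)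

lemma poly_curve_shift: "poly_curve F \<Longrightarrow> poly_curve (\<lambda>e x. e * F e x)"
  using poly_curve_step[OF schwartz_zero] by simp

lemma velocity_shift: "poly_curve F \<Longrightarrow> velocity (\<lambda>e x. e * F e x) = F 0"
  using velocity_step[of F "\<lambda>x. 0"] by simp

lemma poly_curve_line:
  "schwartz f \<Longrightarrow> schwartz g \<Longrightarrow> poly_curve (\<lambda>e x. f x + e * g x)"
  using poly_curve_step[OF _ poly_curve_const] .

lemma velocity_line:
  "schwartz g \<Longrightarrow> velocity (\<lambda>e x. f x + e * g x) = g"
  using velocity_step[OF poly_curve_const] .

lemma poly_curve_add:
  assumes "poly_curve F" "poly_curve G"
  shows "poly_curve (\<lambda>e x. F e x + G e x)"
  using assms
proof (induction arbitrary: G rule: poly_curve.induct)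
  case (poly_curve_const c)
  from poly_curve_const(2) show ?case
  proof cases
    case (poly_curve_const d)
    then show ?thesis using \<open>schwartz c\<close> by (simp add: poly_curve.intros schwartz_add)
  next
    case (poly_curve_step d F)
    then show ?thesis
      using poly_curve.poly_curve_step[OF schwartz_add[OF \<open>schwartz c\<close>], of d F]
      by (simp add: add.assoc)
  qed
next
  case (poly_curve_step c F)
  from poly_curve_step(4) show ?case
  proof cases
    case (poly_curve_const d)
    then show ?thesis
      using poly_curve.poly_curve_step[OF schwartz_add[OF \<open>schwartz c\<close>], of d F] poly_curve_step
      by (simp add: add_ac)
  next
    case (poly_curve_step d G')
    show ?thesis
      using poly_curve.poly_curve_step[OF schwartz_add[OF \<open>schwartz c\<close> poly_curve_step(2)]
          poly_curve_step.IH[OF poly_curve_step(3)]]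
      unfolding poly_curve_step(1) by (simp add: algebra_simps)
  qed
qed

lemma velocity_add:
  "poly_curve F \<Longrightarrow> poly_curve G \<Longrightarrow>
    velocity (\<lambda>e x. F e x + G e x) = (\<lambda>x. velocity F x + velocity G x)"
  unfolding velocity_def[of "\<lambda>e x. F e x + G e x", abs_def]
  by (auto intro!: ext DERIV_imp_deriv derivative_eq_intros poly_curve_has_velocity)

text \<open>Linearity is required on Schwartz functions only, where the derivatives and integrals
  behave. The single law \<open>comb\<close> matches a Horner step c + e * F.\<close>

locale schwartz_linear =
  fixes T :: "(real \<Rightarrow> real) \<Rightarrow> real \<Rightarrow> real"
  assumes schwartz_image: "schwartz f \<Longrightarrow> schwartz (T f)"
    and comb: "schwartz f \<Longrightarrow> schwartz g \<Longrightarrow> T (\<lambda>x. f x + c * g x) x = T f x + c * T g x"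
begin

lemma add: "schwartz f \<Longrightarrow> schwartz g \<Longrightarrow> T (\<lambda>x. f x + g x) x = T f x + T g x"
  using comb[of f g 1] by simp

lemma sub: "schwartz f \<Longrightarrow> schwartz g \<Longrightarrow> T (\<lambda>x. f x - g x) x = T f x - T g x"
  using comb[of f g "-1"] by simp

lemma zero: "T (\<lambda>x. 0) x = 0"
  using comb[OF schwartz_zero schwartz_zero, of 1] by simp

lemma cmult: "schwartz f \<Longrightarrow> T (\<lambda>x. c * f x) x = c * T f x"
  using comb[OF schwartz_zero, of f c] zero by simp

lemma poly_curve_image:
  assumes "poly_curve F"
  shows "poly_curve (\<lambda>e. T (F e))" "velocity (\<lambda>e. T (F e)) = T (velocity F)"
  using assms
proof (induction rule: poly_curve.induct)
  case (poly_curve_const c)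
  case 1 show ?case by (rule poly_curve.intros) (rule schwartz_image, fact)
  case 2 show ?case by (auto simp: velocity_const zero)
next
  case (poly_curve_step c F)
  have e: "(\<lambda>e. T (\<lambda>x. c x + e * F e x)) = (\<lambda>e x. T c x + e * T (F e) x)"
    by (intro ext comb poly_curve_schwartz poly_curve_step)
  case 1 show ?case
    unfolding e by (rule poly_curve.poly_curve_step[OF schwartz_image poly_curve_step(3)]) fact
  case 2 show ?case
    unfolding e by (simp add: velocity_step poly_curve_step)
qed

end

locale schwartz_bilinear =
  fixes T :: "(real \<Rightarrow> real) \<Rightarrow> (real \<Rightarrow> real) \<Rightarrow> real \<Rightarrow> real"
  assumes linear_left: "schwartz g \<Longrightarrow> schwartz_linear (\<lambda>f. T f g)"
    and linear_right: "schwartz f \<Longrightarrow> schwartz_linear (T f)"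
begin

text \<open>The Leibniz rule, by induction on \<open>F\<close> with \<open>G\<close> kept whole:
  linearity in the first slot splits off T c G and leaves e times the curve of the induction
  hypothesis, of which only the value at e = 0 enters the velocity.\<close>

lemma poly_curve_image2:
  assumes "poly_curve F" "poly_curve G"
  shows "poly_curve (\<lambda>e. T (F e) (G e))"
    "velocity (\<lambda>e. T (F e) (G e)) = (\<lambda>x. T (velocity F) (G 0) x + T (F 0) (velocity G) x)"
  using assms
proof (induction rule: poly_curve.induct)
  case (poly_curve_const c)
  interpret L: schwartz_linear "T c" by (rule linear_right) fact
  interpret R: schwartz_linear "\<lambda>f. T f (G 0)" by (intro linear_left poly_curve_schwartz assms)
  case 1 show ?case by (rule L.poly_curve_image(1)) fact
  case 2 show ?case by (simp add: velocity_const R.zero L.poly_curve_image(2)[OF \<open>poly_curve G\<close>])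
next
  case (poly_curve_step c F)
  interpret L: schwartz_linear "T c" by (rule linear_right) fact
  have e: "(\<lambda>e. T (\<lambda>x. c x + e * F e x) (G e)) = (\<lambda>e x. T c (G e) x + e * T (F e) (G e) x)"
    by (intro ext schwartz_linear.comb[OF linear_left] poly_curve_schwartz poly_curve_step assms)
  note L = L.poly_curve_image[OF assms(2)]
  note S = poly_curve_step(3)[OF assms(2)]
  case 1 show ?case
    unfolding e by (intro poly_curve_add poly_curve_shift L S)
  case 2 show ?case
    unfolding e velocity_add[OF L(1) poly_curve_shift[OF S]] velocity_shift[OF S] L(2)
    by (simp add: velocity_step poly_curve_step add.commute)
qed

end

interpretation deriv: schwartz_linear deriv
proof
  fix f g :: "real \<Rightarrow> real" and c x :: real
  assume fg: "schwartz f" "schwartz g"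
  show "schwartz (deriv f)" by (rule schwartz_deriv) fact
  show "deriv (\<lambda>x. f x + c * g x) x = deriv f x + c * deriv g x"
    by (intro DERIV_imp_deriv DERIV_add DERIV_cmult schwartz_has_deriv fg)
qed

interpretation cmult: schwartz_linear "\<lambda>f x. c * f x" for c
  by unfold_locales (auto intro: schwartz_cmult simp: algebra_simps)

interpretation mult: schwartz_bilinear "\<lambda>f g x. f x * g x"
  by unfold_locales (auto intro: schwartz_mult simp: algebra_simps)

text \<open>\<open>Dinv g\<close> need not decay, so \<open>Dinv\<close> alone does not preserve
  Schwartz functions. Its product with a Schwartz function is again Schwartz, hence this product is
  treated as one bilinear operator.\<close>

interpretation mult_Dinv: schwartz_bilinear "\<lambda>f g x. f x * Dinv g x"
  by unfold_locales
     (auto intro: schwartz_Dinv simp: Dinv_add Dinv_cmult schwartz_cmult algebra_simps)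

text \<open>One row of the operator L: \<open>a\<close> is \<alpha> in the first row and - \<alpha>
  in the second.\<close>

definition Lop :: "real \<Rightarrow> real \<Rightarrow> (real \<Rightarrow> real) \<Rightarrow> real \<Rightarrow> real" where
  "Lop a \<beta> f x = a * f x + 1/2 * \<beta> * deriv f x"

interpretation Lop: schwartz_linear "Lop a b" for a b
proof
  fix f g :: "real \<Rightarrow> real" and c x :: real
  assume fg: "schwartz f" "schwartz g"
  show "schwartz (Lop a b f)" unfolding Lop_def[abs_def] by (intro sc fg)
  show "Lop a b (\<lambda>x. f x + c * g x) x = Lop a b f x + c * Lop a b g x"
    unfolding Lop_def deriv.comb[OF fg] by (simp add: algebra_simps)
qed

lemma Lop_deriv:
  assumes "schwartz f" shows "deriv (Lop a \<beta> f) x = Lop a \<beta> (deriv f) x"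
  unfolding Lop_def[abs_def]
  by (intro DERIV_imp_deriv DERIV_add DERIV_cmult schwartz_has_deriv schwartz_deriv assms)

section \<open>The recursion operator and its linearization\<close>

definition rho :: "vfun \<Rightarrow> vfun \<Rightarrow> real \<Rightarrow> real" where
  "rho u v x = snd u x * fst v x + fst u x * snd v x"

lemma rho_schwartz: "u \<in> schwartz_fields \<Longrightarrow> v \<in> schwartz_fields \<Longrightarrow> schwartz (rho u v)"
  unfolding rho_def[abs_def] schwartz_fields_def by (auto intro!: sc)

text \<open>In each row the two columns apply the same operator to \<open>Dinv\<close>, of r v1 and
  of q v2 respectively. Adding them merges the two integrals into \<open>Dinv (rho u v)\<close>, and
  the outer operator factors as \<open>Lop\<close>.\<close>

lemma Phi_Lop:
  assumes "u \<in> schwartz_fields" "v \<in> schwartz_fields"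
  shows "Phi \<alpha> \<beta> u v =
    ((\<lambda>x. 1/2 * deriv (fst v) x - Lop \<alpha> \<beta> (\<lambda>x. fst u x * Dinv (rho u v) x) x),
     (\<lambda>x. (- 1/2) * deriv (snd v) x - Lop (- \<alpha>) \<beta> (\<lambda>x. snd u x * Dinv (rho u v) x) x))"
proof -
  obtain q r f g where e: "u = (q, r)" "v = (f, g)" by (metis surj_pair)
  have s: "schwartz q" "schwartz r" "schwartz f" "schwartz g"
    using assms by (auto simp: e schwartz_fields_def)
  have D: "Dinv (rho u v) = (\<lambda>x. Dinv (\<lambda>y. r y * f y) x + Dinv (\<lambda>y. q y * g y) x)"
    unfolding rho_def[abs_def] e fst_conv snd_conv by (intro ext Dinv_add sc s)
  have "deriv (\<lambda>x. p x * Dinv (rho u v) x) x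
    = deriv (\<lambda>x. p x * Dinv (\<lambda>y. r y * f y) x) x + deriv (\<lambda>x. p x * Dinv (\<lambda>y. q y * g y) x) x"
    if "schwartz p" for p x
    unfolding D distrib_left by (intro deriv.add sc s that)
  with s show ?thesis
    by (simp add: e Lop_def fun_eq_iff) (simp add: D[unfolded e] algebra_simps)
qed

text \<open>The derivative of \<open>Phi\<close> at \<open>u\<close> in the direction
  \<open>w\<close>, applied to \<open>v\<close>. The field \<open>u\<close> occurs as the outer
  factor and inside \<open>rho\<close>, while the term with the derivative of \<open>v\<close> is
  free of it.\<close>

definition dPhi :: "real \<Rightarrow> real \<Rightarrow> vfun \<Rightarrow> vfun \<Rightarrow> vfun \<Rightarrow> vfun" where
  "dPhi \<alpha> \<beta> u w v =
    ((\<lambda>x. - Lop \<alpha> \<beta> (\<lambda>x. fst w x * Dinv (rho u v) x + fst u x * Dinv (rho w v) x) x),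
     (\<lambda>x. - Lop (- \<alpha>) \<beta> (\<lambda>x. snd w x * Dinv (rho u v) x + snd u x * Dinv (rho w v) x) x))"

definition poly_vcurve :: "(real \<Rightarrow> vfun) \<Rightarrow> bool" where
  "poly_vcurve W \<longleftrightarrow> poly_curve (\<lambda>e. fst (W e)) \<and> poly_curve (\<lambda>e. snd (W e))"

definition vvelocity :: "(real \<Rightarrow> vfun) \<Rightarrow> vfun" where
  "vvelocity W = (velocity (\<lambda>e. fst (W e)), velocity (\<lambda>e. snd (W e)))"

lemma poly_vcurve_schwartz: "poly_vcurve W \<Longrightarrow> W e \<in> schwartz_fields"
  by (simp add: poly_vcurve_def schwartz_fields_def poly_curve_schwartz[of "\<lambda>e. fst (W e)"]
      poly_curve_schwartz[of "\<lambda>e. snd (W e)"])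

lemma vvelocity_schwartz: "poly_vcurve W \<Longrightarrow> vvelocity W \<in> schwartz_fields"
  by (simp add: poly_vcurve_def vvelocity_def schwartz_fields_def velocity_schwartz)

lemma gateaux_eq_vvelocity: "gateaux K u S = vvelocity (\<lambda>e. K (displace u e S))"
  by (simp add: gateaux_def vvelocity_def velocity_def[abs_def])

lemma poly_vcurve_rho:
  assumes "poly_vcurve U" "poly_vcurve V"
  shows "poly_curve (\<lambda>e. rho (U e) (V e))"
    "velocity (\<lambda>e. rho (U e) (V e)) = (\<lambda>x. rho (vvelocity U) (V 0) x + rho (U 0) (vvelocity V) x)"
proof -
  have c: "poly_curve (\<lambda>e. fst (U e))" "poly_curve (\<lambda>e. snd (U e))"
    "poly_curve (\<lambda>e. fst (V e))" "poly_curve (\<lambda>e. snd (V e))"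
    using assms by (auto simp: poly_vcurve_def)
  note m = mult.poly_curve_image2[OF c(2,3)] mult.poly_curve_image2[OF c(1,4)]
  show "poly_curve (\<lambda>e. rho (U e) (V e))"
    unfolding rho_def[abs_def] by (intro poly_curve_add m)
  show "velocity (\<lambda>e. rho (U e) (V e)) = (\<lambda>x. rho (vvelocity U) (V 0) x + rho (U 0) (vvelocity V) x)"
    unfolding rho_def[abs_def] velocity_add[OF m(1,3)] m(2,4)
    by (simp add: vvelocity_def fun_eq_iff)
qed

text \<open>The parameters \<open>c\<close> and \<open>a\<close> let one computation serve both
  rows, with (1/2, \<alpha>) and (-1/2, - \<alpha>).\<close>

lemma velocity_Phi_component:
  assumes Q: "poly_curve Q" and F: "poly_curve F" and R: "poly_curve R"
  shows "poly_curve (\<lambda>e x. c * deriv (F e) x - Lop a \<beta> (\<lambda>x. Q e x * Dinv (R e) x) x)"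
    "velocity (\<lambda>e x. c * deriv (F e) x - Lop a \<beta> (\<lambda>x. Q e x * Dinv (R e) x) x)
      = (\<lambda>x. c * deriv (velocity F) x
          - Lop a \<beta> (\<lambda>x. velocity Q x * Dinv (R 0) x + Q 0 x * Dinv (velocity R) x) x)"
proof -
  note D = cmult.poly_curve_image[OF deriv.poly_curve_image(1)[OF F], of c]
  note L = cmult.poly_curve_image[OF Lop.poly_curve_image(1)[OF mult_Dinv.poly_curve_image2(1)[OF Q R]], of "-1" a \<beta>]
  have e: "(\<lambda>e x. c * deriv (F e) x - Lop a \<beta> (\<lambda>x. Q e x * Dinv (R e) x) x)
    = (\<lambda>e x. c * deriv (F e) x + (- 1) * Lop a \<beta> (\<lambda>x. Q e x * Dinv (R e) x) x)" by simp
  show "poly_curve (\<lambda>e x. c * deriv (F e) x - Lop a \<beta> (\<lambda>x. Q e x * Dinv (R e) x) x)"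
    unfolding e by (intro poly_curve_add D L)
  show "velocity (\<lambda>e x. c * deriv (F e) x - Lop a \<beta> (\<lambda>x. Q e x * Dinv (R e) x) x)
      = (\<lambda>x. c * deriv (velocity F) x
          - Lop a \<beta> (\<lambda>x. velocity Q x * Dinv (R 0) x + Q 0 x * Dinv (velocity R) x) x)"
    unfolding e velocity_add[OF D(1) L(1)] D(2) L(2) deriv.poly_curve_image(2)[OF F]
      Lop.poly_curve_image(2)[OF mult_Dinv.poly_curve_image2(1)[OF Q R]]
      mult_Dinv.poly_curve_image2(2)[OF Q R]
    by simp
qed

lemma vsub_schwartz: "v \<in> schwartz_fields \<Longrightarrow> w \<in> schwartz_fields \<Longrightarrow> vsub v w \<in> schwartz_fields"
  by (simp add: vsub_def schwartz_fields_def schwartz_sub)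

text \<open>Letting both arguments move covers two uses: a constant \<open>V\<close> gives the
  derivative of the operator, and \<open>K\<close> along a line gives the derivative of the vector
  field \<open>Phi\<close> applied to \<open>K\<close>.\<close>

lemma poly_vcurve_Phi:
  assumes U: "poly_vcurve U" and V: "poly_vcurve V"
  shows "poly_vcurve (\<lambda>e. Phi \<alpha> \<beta> (U e) (V e))"
    "vvelocity (\<lambda>e. Phi \<alpha> \<beta> (U e) (V e))
      = vadd (dPhi \<alpha> \<beta> (U 0) (vvelocity U) (V 0)) (Phi \<alpha> \<beta> (U 0) (vvelocity V))"
proof -
  have c: "poly_curve (\<lambda>e. fst (U e))" "poly_curve (\<lambda>e. snd (U e))"
    "poly_curve (\<lambda>e. fst (V e))" "poly_curve (\<lambda>e. snd (V e))"
    using assms by (auto simp: poly_vcurve_def)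
  note R = poly_vcurve_rho[OF U V]
  note P = Phi_Lop[OF poly_vcurve_schwartz[OF U] poly_vcurve_schwartz[OF V]]
  show "poly_vcurve (\<lambda>e. Phi \<alpha> \<beta> (U e) (V e))"
    unfolding poly_vcurve_def P fst_conv snd_conv
    by (intro conjI velocity_Phi_component c R)
  have u: "U 0 \<in> schwartz_fields" "V 0 \<in> schwartz_fields" "vvelocity U \<in> schwartz_fields"
      "vvelocity V \<in> schwartz_fields"
    using U V by (auto intro: poly_vcurve_schwartz vvelocity_schwartz)
  have *: "Lop a \<beta> (\<lambda>x. p' x * Dinv (rho (U 0) (V 0)) x
        + p x * Dinv (\<lambda>x. rho (vvelocity U) (V 0) x + rho (U 0) (vvelocity V) x) x) x
      = Lop a \<beta> (\<lambda>x. p' x * Dinv (rho (U 0) (V 0)) x + p x * Dinv (rho (vvelocity U) (V 0)) x) x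
        + Lop a \<beta> (\<lambda>x. p x * Dinv (rho (U 0) (vvelocity V)) x) x"
    if "schwartz p" "schwartz p'" for p p' a x
    unfolding Dinv_add[OF rho_schwartz[OF u(3,2)] rho_schwartz[OF u(1,4)]] distrib_left add.assoc[symmetric]
    by (intro Lop.add sc that rho_schwartz u)
  have v: "velocity (\<lambda>e x. c * deriv (F e) x - Lop a \<beta> (\<lambda>x. Q e x * Dinv (rho (U e) (V e)) x) x)
      = (\<lambda>x. - Lop a \<beta> (\<lambda>x. velocity Q x * Dinv (rho (U 0) (V 0)) x
            + Q 0 x * Dinv (rho (vvelocity U) (V 0)) x) x
          + (c * deriv (velocity F) x - Lop a \<beta> (\<lambda>x. Q 0 x * Dinv (rho (U 0) (vvelocity V)) x) x))"
    if "poly_curve Q" "poly_curve F" for Q F a c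
    unfolding velocity_Phi_component(2)[OF that R(1)] R(2)
      *[OF poly_curve_schwartz[OF that(1)] velocity_schwartz[OF that(1)]]
    by (simp add: algebra_simps)
  show "vvelocity (\<lambda>e. Phi \<alpha> \<beta> (U e) (V e))
      = vadd (dPhi \<alpha> \<beta> (U 0) (vvelocity U) (V 0)) (Phi \<alpha> \<beta> (U 0) (vvelocity V))"
    unfolding vvelocity_def[of "\<lambda>e. Phi \<alpha> \<beta> (U e) (V e)"] P Phi_Lop[OF u(1,4)] dPhi_def vadd_def
      fst_conv snd_conv
    using v[OF c(1,3), of "1/2" \<alpha>] v[OF c(2,4), of "- 1/2" "- \<alpha>"]
    by (simp add: vvelocity_def)
qed

lemma dPhi_schwartz:
  assumes "u \<in> schwartz_fields" "w \<in> schwartz_fields" "v \<in> schwartz_fields"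
  shows "dPhi \<alpha> \<beta> u w v \<in> schwartz_fields"
proof -
  have s: "schwartz (fst u)" "schwartz (snd u)" "schwartz (fst w)" "schwartz (snd w)"
    using assms by (auto simp: schwartz_fields_def)
  show ?thesis
    unfolding dPhi_def schwartz_fields_def mem_Collect_eq fst_conv snd_conv
    by (intro conjI schwartz_uminus Lop.schwartz_image sc rho_schwartz s assms)
qed

lemma Phi_vcomb:
  assumes "u \<in> schwartz_fields" "v \<in> schwartz_fields" "w \<in> schwartz_fields"
  shows "Phi \<alpha> \<beta> u ((\<lambda>x. fst v x + c * fst w x), (\<lambda>x. snd v x + c * snd w x))
    = ((\<lambda>x. fst (Phi \<alpha> \<beta> u v) x + c * fst (Phi \<alpha> \<beta> u w) x),
       (\<lambda>x. snd (Phi \<alpha> \<beta> u v) x + c * snd (Phi \<alpha> \<beta> u w) x))"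
proof -
  let ?z = "((\<lambda>x. fst v x + c * fst w x), (\<lambda>x. snd v x + c * snd w x))"
  have s: "schwartz (fst u)" "schwartz (snd u)" "schwartz (fst v)" "schwartz (snd v)"
    "schwartz (fst w)" "schwartz (snd w)"
    using assms by (auto simp: schwartz_fields_def)
  have z: "?z \<in> schwartz_fields"
    using s by (simp add: schwartz_fields_def schwartz_add schwartz_cmult)
  have r: "rho u ?z = (\<lambda>x. rho u v x + c * rho u w x)"
    by (simp add: rho_def fun_eq_iff algebra_simps)
  have D: "Dinv (rho u ?z) x = Dinv (rho u v) x + c * Dinv (rho u w) x" for x
    unfolding r Dinv_cmult[symmetric]
    by (intro Dinv_add schwartz_cmult rho_schwartz assms)
  have L: "Lop a \<beta> (\<lambda>x. p x * Dinv (rho u ?z) x) x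
      = Lop a \<beta> (\<lambda>x. p x * Dinv (rho u v) x) x + c * Lop a \<beta> (\<lambda>x. p x * Dinv (rho u w) x) x"
    if "schwartz p" for p a x
    unfolding D distrib_left mult.left_commute[of _ c]
    by (intro Lop.comb sc that rho_schwartz assms)
  show ?thesis
    unfolding Phi_Lop[OF assms(1) z] Phi_Lop[OF assms(1,2)] Phi_Lop[OF assms(1,3)]
      L[OF s(1)] L[OF s(2)] fst_conv snd_conv
    by (simp add: deriv.comb s fun_eq_iff) (simp add: algebra_simps)
qed

lemma Phi_vadd:
  "u \<in> schwartz_fields \<Longrightarrow> v \<in> schwartz_fields \<Longrightarrow> w \<in> schwartz_fields \<Longrightarrow>
    Phi \<alpha> \<beta> u (vadd v w) = vadd (Phi \<alpha> \<beta> u v) (Phi \<alpha> \<beta> u w)"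
  using Phi_vcomb[of u v w \<alpha> \<beta> 1] by (simp add: vadd_def)

lemma Phi_vsub:
  "u \<in> schwartz_fields \<Longrightarrow> v \<in> schwartz_fields \<Longrightarrow> w \<in> schwartz_fields \<Longrightarrow>
    Phi \<alpha> \<beta> u (vsub v w) = vsub (Phi \<alpha> \<beta> u v) (Phi \<alpha> \<beta> u w)"
  using Phi_vcomb[of u v w \<alpha> \<beta> "-1"] by (simp add: vsub_def)

lemma vzero_schwartz: "vzero \<in> schwartz_fields"
  by (simp add: vzero_def schwartz_fields_def schwartz_zero)

lemma vsub_self: "vsub v v = vzero"
  by (simp add: vsub_def vzero_def)

lemma vadd_vzero: "vadd v vzero = v"
  by (simp add: vadd_def vzero_def)

lemma Phi_vzero: "u \<in> schwartz_fields \<Longrightarrow> Phi \<alpha> \<beta> u vzero = vzero"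
  using Phi_vsub[of u vzero vzero \<alpha> \<beta>] vzero_schwartz by (simp add: vsub_self)

section \<open>Vanishing of the Nijenhuis torsion\<close>

lemma rho_commute: "rho u v = rho v u"
  by (simp add: rho_def fun_eq_iff)

lemma (in schwartz_linear) four_terms:
  assumes "schwartz f" "schwartz g" "schwartz h" "schwartz k"
  shows "T (\<lambda>x. (f x - g x) + (c * h x - k x)) x = (T f x - T g x) + (c * T h x - T k x)"
  by (simp only: add schwartz_sub schwartz_cmult sub cmult assms)

text \<open>The terms with \<open>rho w v\<close> are symmetric in the two directions and
  cancel.\<close>

lemma dPhi_antisym:
  assumes "u \<in> schwartz_fields" "v \<in> schwartz_fields" "w \<in> schwartz_fields"
  shows "vsub (dPhi \<alpha> \<beta> u w v) (dPhi \<alpha> \<beta> u v w) =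
    (Lop \<alpha> \<beta> (\<lambda>x. fst v x * Dinv (rho u w) x - fst w x * Dinv (rho u v) x),
     Lop (- \<alpha>) \<beta> (\<lambda>x. snd v x * Dinv (rho u w) x - snd w x * Dinv (rho u v) x))"
proof -
  have s: "schwartz (fst u)" "schwartz (snd u)" "schwartz (fst v)" "schwartz (snd v)"
    "schwartz (fst w)" "schwartz (snd w)"
    using assms by (auto simp: schwartz_fields_def)
  have L: "- Lop a \<beta> (\<lambda>x. f x * Dinv (rho u v) x + p x * Dinv (rho w v) x) x
      - - Lop a \<beta> (\<lambda>x. g x * Dinv (rho u w) x + p x * Dinv (rho v w) x) x
      = Lop a \<beta> (\<lambda>x. g x * Dinv (rho u w) x - f x * Dinv (rho u v) x) x"
    if "schwartz f" "schwartz g" "schwartz p" for a f g p x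
  proof -
    have m: "schwartz (\<lambda>x. f x * Dinv (rho u v) x)" "schwartz (\<lambda>x. g x * Dinv (rho u w) x)"
      "schwartz (\<lambda>x. p x * Dinv (rho w v) x)"
      by (intro sc rho_schwartz assms that)+
    show ?thesis
      unfolding rho_commute[of v w] Lop.add[OF m(1,3)] Lop.add[OF m(2,3)] Lop.sub[OF m(2,1)] by simp
  qed
  show ?thesis
    unfolding dPhi_def vsub_def fst_conv snd_conv L[OF s(5,3,1)] L[OF s(6,4,2)] ..
qed

text \<open>The torsion vanishes without boundary terms: the three nonlocal terms that it
  contains add up to \<open>Dinv\<close> of the derivative of an explicit Schwartz function.\<close>

lemma Nijenhuis_torsion_Phi:
  assumes u: "u \<in> schwartz_fields" and X: "X \<in> schwartz_fields" and S: "S \<in> schwartz_fields"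
  shows "vadd (vsub (dPhi \<alpha> \<beta> u (Phi \<alpha> \<beta> u X) S) (dPhi \<alpha> \<beta> u (Phi \<alpha> \<beta> u S) X))
    (Phi \<alpha> \<beta> u (vsub (dPhi \<alpha> \<beta> u S X) (dPhi \<alpha> \<beta> u X S))) = vzero"
proof -
  obtain q r f g h k where e: "u = (q, r)" "X = (f, g)" "S = (h, k)" by (metis surj_pair)
  have s: "schwartz q" "schwartz r" "schwartz f" "schwartz g" "schwartz h" "schwartz k"
    using assms by (auto simp: e schwartz_fields_def)
  define \<rho> \<sigma> where "\<rho> = rho u X" and "\<sigma> = rho u S"
  define a b where "a = Dinv \<rho>" and "b = Dinv \<sigma>"
  have rs: "schwartz \<rho>" "schwartz \<sigma>" unfolding \<rho>_def \<sigma>_def by (intro rho_schwartz assms)+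
  have pa: "schwartz (\<lambda>x. p x * a x)" and pb: "schwartz (\<lambda>x. p x * b x)" if "schwartz p" for p
    unfolding a_def b_def by (intro sc that rs)+
  note d = schwartz_has_deriv[OF s(1)] schwartz_has_deriv[OF s(2)] schwartz_has_deriv[OF s(3)]
    schwartz_has_deriv[OF s(4)] schwartz_has_deriv[OF s(5)] schwartz_has_deriv[OF s(6)]
  have da: "(a has_real_derivative \<rho> x) (at x)" and db: "(b has_real_derivative \<sigma> x) (at x)" for x
    unfolding a_def b_def by (intro schwartz_Dinv_has_deriv rs)+
  have \<rho>: "\<rho> x = r x * f x + q x * g x" and \<sigma>: "\<sigma> x = r x * h x + q x * k x" for x
    by (simp_all add: \<rho>_def \<sigma>_def rho_def e)
  define d\<rho> where "d\<rho> x = deriv r x * f x + r x * deriv f x + (deriv q x * g x + q x * deriv g x)" for x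
  define d\<sigma> where "d\<sigma> x = deriv r x * h x + r x * deriv h x + (deriv q x * k x + q x * deriv k x)" for x
  have d\<rho>: "(\<rho> has_real_derivative d\<rho> x) (at x)" and d\<sigma>: "(\<sigma> has_real_derivative d\<sigma> x) (at x)" for x
    unfolding \<rho>[abs_def] \<sigma>[abs_def] d\<rho>_def d\<sigma>_def
    by (auto intro!: derivative_eq_intros d simp: algebra_simps)
  \<comment> \<open>These are the arguments of \<open>Lop\<close> left by
    \<open>dPhi_antisym\<close>. They are named without \<open>Lop\<close> because the final
    identity is checked inside it.\<close>
  define Z1 Z2 where "Z1 = (\<lambda>x. f x * b x - h x * a x)" and "Z2 = (\<lambda>x. g x * b x - k x * a x)"
  have Z: "schwartz Z1" "schwartz Z2"
    unfolding Z1_def Z2_def by (intro schwartz_sub pa pb s)+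
  have dZ: "deriv Z1 x = deriv f x * b x + f x * \<sigma> x - (deriv h x * a x + h x * \<rho> x)"
    "deriv Z2 x = deriv g x * b x + g x * \<sigma> x - (deriv k x * a x + k x * \<rho> x)" for x
    unfolding Z1_def Z2_def
    by (rule DERIV_imp_deriv, (rule derivative_eq_intros d da db refl)+, simp add: algebra_simps)+
  define Y where "Y = (Lop \<alpha> \<beta> Z1, Lop (- \<alpha>) \<beta> Z2)"
  have Y: "Y \<in> schwartz_fields"
    by (simp add: Y_def schwartz_fields_def Lop.schwartz_image Z)
  have Yeq: "vsub (dPhi \<alpha> \<beta> u S X) (dPhi \<alpha> \<beta> u X S) = Y"
    unfolding dPhi_antisym[OF u X S] Y_def Z1_def Z2_def a_def b_def \<rho>_def \<sigma>_def by (simp add: e)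
  have Lqa: "Lop c \<beta> (\<lambda>x. p x * a x) x = c * p x * a x + 1/2 * \<beta> * (deriv p x * a x + p x * \<rho> x)"
    "Lop c \<beta> (\<lambda>x. p x * b x) x = c * p x * b x + 1/2 * \<beta> * (deriv p x * b x + p x * \<sigma> x)"
    if "schwartz p" for c p x
  proof -
    have "deriv (\<lambda>x. p x * a x) x = deriv p x * a x + p x * \<rho> x"
      "deriv (\<lambda>x. p x * b x) x = deriv p x * b x + p x * \<sigma> x"
      by (auto intro!: DERIV_imp_deriv derivative_eq_intros schwartz_has_deriv[OF that] da db
          simp: algebra_simps)
    then show "Lop c \<beta> (\<lambda>x. p x * a x) x = c * p x * a x + 1/2 * \<beta> * (deriv p x * a x + p x * \<rho> x)"
      "Lop c \<beta> (\<lambda>x. p x * b x) x = c * p x * b x + 1/2 * \<beta> * (deriv p x * b x + p x * \<sigma> x)"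
      by (simp_all add: Lop_def)
  qed
  define X1 X2 S1 S2 where "X1 = fst (Phi \<alpha> \<beta> u X)" and "X2 = snd (Phi \<alpha> \<beta> u X)"
    and "S1 = fst (Phi \<alpha> \<beta> u S)" and "S2 = snd (Phi \<alpha> \<beta> u S)"
  note Pdefs = X1_def X2_def S1_def S2_def
  have P: "Phi \<alpha> \<beta> u X \<in> schwartz_fields" "Phi \<alpha> \<beta> u S \<in> schwartz_fields"
    by (intro Phi_schwartz assms)+
  then have sP: "schwartz X1" "schwartz X2" "schwartz S1" "schwartz S2"
    by (auto simp: Pdefs schwartz_fields_def)
  have X12: "X1 x = 1/2 * deriv f x - (\<alpha> * q x * a x + 1/2 * \<beta> * (deriv q x * a x + q x * \<rho> x))"
     "X2 x = (- 1/2) * deriv g x - (- \<alpha> * r x * a x + 1/2 * \<beta> * (deriv r x * a x + r x * \<rho> x))" for x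
    unfolding Pdefs Phi_Lop[OF u X] \<rho>_def[symmetric] a_def[symmetric] Lqa[OF s(1), symmetric]
      Lqa[OF s(2), symmetric] by (simp_all add: e)
  have S12: "S1 x = 1/2 * deriv h x - (\<alpha> * q x * b x + 1/2 * \<beta> * (deriv q x * b x + q x * \<sigma> x))"
     "S2 x = (- 1/2) * deriv k x - (- \<alpha> * r x * b x + 1/2 * \<beta> * (deriv r x * b x + r x * \<sigma> x))" for x
    unfolding Pdefs Phi_Lop[OF u S] \<sigma>_def[symmetric] b_def[symmetric] Lqa[OF s(1), symmetric]
      Lqa[OF s(2), symmetric] by (simp_all add: e)
  \<comment> \<open>An antiderivative of the three sources combined in \<open>key\<close>: the terms
    from the local half derivatives integrate to (f k - g h) / 2, the terms in \<alpha> cancel, and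
    those in \<beta> integrate to the last bracket.\<close>
  define G where "G = (\<lambda>x. 1/2 * (f x * k x - g x * h x) + 1/2 * \<beta> * (\<rho> x * b x - \<sigma> x * a x))"
  have G: "schwartz G"
    unfolding G_def by (intro schwartz_add schwartz_cmult schwartz_sub schwartz_mult pa pb s rs)
  have dG: "deriv G x = 1/2 * (deriv f x * k x + f x * deriv k x - (deriv g x * h x + g x * deriv h x))
      + 1/2 * \<beta> * (d\<rho> x * b x - d\<sigma> x * a x)" for x
    unfolding G_def
    by (rule DERIV_imp_deriv, (rule derivative_eq_intros d da db d\<rho> d\<sigma> refl)+, simp add: algebra_simps)
  have key: "rho (Phi \<alpha> \<beta> u X) S x - rho (Phi \<alpha> \<beta> u S) X x + rho u Y x = deriv G x" for x
    unfolding rho_def Pdefs[symmetric] unfolding dG X12 S12 e Y_def Lop_def dZ d\<rho>_def d\<sigma>_def \<rho> \<sigma>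
      fst_conv snd_conv
    unfolding Z1_def Z2_def by (simp add: algebra_simps)
  define D1 D2 D3 where "D1 = Dinv (rho (Phi \<alpha> \<beta> u X) S)" and "D2 = Dinv (rho (Phi \<alpha> \<beta> u S) X)"
    and "D3 = Dinv (rho u Y)"
  \<comment> \<open>As \<open>G\<close> is Schwartz, \<open>Dinv\<close> recovers it from its
    derivative with no constant. This relation eliminates \<open>D3\<close>, after which
    \<open>D1\<close> and \<open>D2\<close> cancel too.\<close>
  have D: "D1 x - D2 x + D3 x = G x" for x
  proof -
    note rs' = rho_schwartz[OF P(1) S] rho_schwartz[OF P(2) X]
    have "D1 x - D2 x + D3 x
        = Dinv (\<lambda>x. rho (Phi \<alpha> \<beta> u X) S x - rho (Phi \<alpha> \<beta> u S) X x + rho u Y x) x"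
      unfolding Dinv_add[OF schwartz_sub[OF rs'] rho_schwartz[OF u Y]] Dinv_sub[OF rs']
        D1_def D2_def D3_def ..
    also have "\<dots> = Dinv (deriv G) x" by (simp only: key)
    also have "\<dots> = G x" by (rule Dinv_deriv_schwartz[OF G])
    finally show ?thesis .
  qed
  have D3: "D3 x = G x - D1 x + D2 x" for x using D[of x] by linarith
  have pD: "schwartz (\<lambda>x. p x * D1 x)" "schwartz (\<lambda>x. p x * D2 x)" "schwartz (\<lambda>x. p x * D3 x)"
    if "schwartz p" for p
    unfolding D1_def D2_def D3_def by (intro sc that rho_schwartz assms P Y)+
  have 1: "- Lop \<alpha> \<beta> (\<lambda>x. X1 x * b x + q x * D1 x) x - - Lop \<alpha> \<beta> (\<lambda>x. S1 x * a x + q x * D2 x) x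
      + (1/2 * deriv (Lop \<alpha> \<beta> Z1) x - Lop \<alpha> \<beta> (\<lambda>x. q x * D3 x) x) = 0" for x
  proof -
    \<comment> \<open>Since \<open>Lop\<close> is linear and commutes with the derivative, it can be
      pulled out of the whole row; its argument vanishes pointwise.\<close>
    have "(S1 x * a x + q x * D2 x) - (X1 x * b x + q x * D1 x) + (1/2 * deriv Z1 x - q x * D3 x) = 0" for x
      unfolding D3 G_def X12 S12 dZ \<rho> \<sigma> by (simp add: algebra_simps)
    then have "0 = Lop \<alpha> \<beta> (\<lambda>x. ((S1 x * a x + q x * D2 x) - (X1 x * b x + q x * D1 x))
        + (1/2 * deriv Z1 x - q x * D3 x)) x"
      by (simp only: Lop.zero)
    also have "\<dots> = Lop \<alpha> \<beta> (\<lambda>x. S1 x * a x + q x * D2 x) x - Lop \<alpha> \<beta> (\<lambda>x. X1 x * b x + q x * D1 x) x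
        + (1/2 * Lop \<alpha> \<beta> (deriv Z1) x - Lop \<alpha> \<beta> (\<lambda>x. q x * D3 x) x)"
      by (intro Lop.four_terms schwartz_add schwartz_deriv pa pb pD s sP Z)
    finally show ?thesis unfolding Lop_deriv[OF Z(1)] by simp
  qed
  have 2: "- Lop (- \<alpha>) \<beta> (\<lambda>x. X2 x * b x + r x * D1 x) x - - Lop (- \<alpha>) \<beta> (\<lambda>x. S2 x * a x + r x * D2 x) x
      + ((- 1/2) * deriv (Lop (- \<alpha>) \<beta> Z2) x - Lop (- \<alpha>) \<beta> (\<lambda>x. r x * D3 x) x) = 0" for x
  proof -
    have "(S2 x * a x + r x * D2 x) - (X2 x * b x + r x * D1 x) + ((- 1/2) * deriv Z2 x - r x * D3 x) = 0" for x
      unfolding D3 G_def X12 S12 dZ \<rho> \<sigma> by (simp add: algebra_simps)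
    then have "0 = Lop (- \<alpha>) \<beta> (\<lambda>x. ((S2 x * a x + r x * D2 x) - (X2 x * b x + r x * D1 x))
        + ((- 1/2) * deriv Z2 x - r x * D3 x)) x"
      by (simp only: Lop.zero)
    also have "\<dots> = Lop (- \<alpha>) \<beta> (\<lambda>x. S2 x * a x + r x * D2 x) x - Lop (- \<alpha>) \<beta> (\<lambda>x. X2 x * b x + r x * D1 x) x
        + ((- 1/2) * Lop (- \<alpha>) \<beta> (deriv Z2) x - Lop (- \<alpha>) \<beta> (\<lambda>x. r x * D3 x) x)"
      by (intro Lop.four_terms schwartz_add schwartz_deriv pa pb pD s sP Z)
    finally show ?thesis unfolding Lop_deriv[OF Z(2)] by simp
  qed
  have e': "fst u = q" "snd u = r" "fst Y = Lop \<alpha> \<beta> Z1" "snd Y = Lop (- \<alpha>) \<beta> Z2"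
    by (simp_all add: e Y_def)
  show ?thesis
    unfolding Yeq
    unfolding Phi_Lop[OF u Y] dPhi_def vadd_def vsub_def fst_conv snd_conv Pdefs[symmetric]
      D1_def[symmetric] D2_def[symmetric] D3_def[symmetric] \<rho>_def[symmetric] \<sigma>_def[symmetric]
      a_def[symmetric] b_def[symmetric] e' 1 2 vzero_def ..
qed

section \<open>Lie derivatives and commuting flows\<close>

lemma displace_0: "displace u 0 S = u"
  by (simp add: displace_def)

lemma poly_vcurve_displace:
  assumes "u \<in> schwartz_fields" "S \<in> schwartz_fields"
  shows "poly_vcurve (\<lambda>e. displace u e S)" "vvelocity (\<lambda>e. displace u e S) = S"
  using assms
  by (auto simp: poly_vcurve_def vvelocity_def displace_def schwartz_fields_def
      poly_curve_line velocity_line)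

lemma poly_vcurve_const:
  "S \<in> schwartz_fields \<Longrightarrow> poly_vcurve (\<lambda>e. S)" "vvelocity (\<lambda>e. S) = vzero"
  by (auto simp: poly_vcurve_def vvelocity_def schwartz_fields_def poly_curve_const
      velocity_const vzero_def)

text \<open>Polynomial dependence along every line u + e S: \<open>Phi\<close> preserves it, and it
  makes the pointwise Gateaux derivative obey the product rule.\<close>

definition poly_field :: "(vfun \<Rightarrow> vfun) \<Rightarrow> bool" where
  "poly_field K \<longleftrightarrow>
    (\<forall>u\<in>schwartz_fields. \<forall>S\<in>schwartz_fields. poly_vcurve (\<lambda>e. K (displace u e S)))"

lemma poly_field_curve:
  "poly_field K \<Longrightarrow> u \<in> schwartz_fields \<Longrightarrow> S \<in> schwartz_fields \<Longrightarrow> poly_vcurve (\<lambda>e. K (displace u e S))"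
  by (simp add: poly_field_def)

lemma poly_field_schwartz:
  assumes "poly_field K" "u \<in> schwartz_fields" shows "K u \<in> schwartz_fields"
  using poly_vcurve_schwartz[OF poly_field_curve[OF assms assms(2)], of 0] by (simp add: displace_0)

lemma gateaux_schwartz:
  "poly_field K \<Longrightarrow> u \<in> schwartz_fields \<Longrightarrow> S \<in> schwartz_fields \<Longrightarrow> gateaux K u S \<in> schwartz_fields"
  unfolding gateaux_eq_vvelocity by (intro vvelocity_schwartz poly_field_curve)

lemma gateaux_Phi_const:
  assumes "u \<in> schwartz_fields" "S \<in> schwartz_fields" "X \<in> schwartz_fields"
  shows "gateaux (\<lambda>w. Phi \<alpha> \<beta> w S) u X = dPhi \<alpha> \<beta> u X S"
  unfolding gateaux_eq_vvelocity
    poly_vcurve_Phi(2)[OF poly_vcurve_displace(1)[OF assms(1,3)] poly_vcurve_const(1)[OF assms(2)]]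
  by (simp add: displace_0 poly_vcurve_displace poly_vcurve_const assms Phi_vzero vadd_vzero)

lemma poly_field_Phi: "poly_field K \<Longrightarrow> poly_field (\<lambda>w. Phi \<alpha> \<beta> w (K w))"
  by (auto simp: poly_field_def intro!: poly_vcurve_Phi poly_vcurve_displace)

lemma gateaux_Phi:
  assumes "poly_field K" "u \<in> schwartz_fields" "S \<in> schwartz_fields"
  shows "gateaux (\<lambda>w. Phi \<alpha> \<beta> w (K w)) u S
    = vadd (dPhi \<alpha> \<beta> u S (K u)) (Phi \<alpha> \<beta> u (gateaux K u S))"
  unfolding gateaux_eq_vvelocity
    poly_vcurve_Phi(2)[OF poly_vcurve_displace(1)[OF assms(2,3)] poly_field_curve[OF assms]]
  by (simp add: displace_0 poly_vcurve_displace assms)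

lemma lie_deriv_op_Phi:
  assumes "poly_field K" "u \<in> schwartz_fields" "S \<in> schwartz_fields"
  shows "lie_deriv_op K (Phi \<alpha> \<beta>) u S
    = vadd (vsub (dPhi \<alpha> \<beta> u (K u) S) (gateaux K u (Phi \<alpha> \<beta> u S))) (Phi \<alpha> \<beta> u (gateaux K u S))"
  by (simp add: lie_deriv_op_def gateaux_Phi_const assms poly_field_schwartz)

text \<open>After expanding both sides the terms with the derivative of \<open>K\<close> agree, and
  the difference is the torsion at X = K u.\<close>

lemma lie_deriv_op_Phi_Phi:
  assumes K: "poly_field K" and u: "u \<in> schwartz_fields" and S: "S \<in> schwartz_fields"
  shows "lie_deriv_op (\<lambda>w. Phi \<alpha> \<beta> w (K w)) (Phi \<alpha> \<beta>) u S
    = Phi \<alpha> \<beta> u (lie_deriv_op K (Phi \<alpha> \<beta>) u S)"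
proof -
  note Ku = poly_field_schwartz[OF K u]
  note PS = Phi_schwartz[OF u S, of \<alpha> \<beta>]
  note m = dPhi_schwartz[OF u Ku S, of \<alpha> \<beta>] dPhi_schwartz[OF u S Ku, of \<alpha> \<beta>]
    gateaux_schwartz[OF K u PS] Phi_schwartz[OF u gateaux_schwartz[OF K u S], of \<alpha> \<beta>]
  note T = Nijenhuis_torsion_Phi[OF u Ku S, of \<alpha> \<beta>, unfolded Phi_vsub[OF u m(2,1)]]
  show ?thesis
    using T
    unfolding lie_deriv_op_Phi[OF poly_field_Phi[OF K] u S] lie_deriv_op_Phi[OF K u S]
      gateaux_Phi[OF K u S] gateaux_Phi[OF K u PS]
      Phi_vadd[OF u m(2,4)] Phi_vadd[OF u vsub_schwartz[OF m(1,3)] m(4)] Phi_vsub[OF u m(1,3)]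
    by (simp add: vadd_def vsub_def vzero_def fun_eq_iff) (smt (verit))
qed

lemma Kvf_0: "Kvf \<alpha> \<beta> 0 = (\<lambda>u. ((\<lambda>x. 2 * fst u x), (\<lambda>x. - 2 * snd u x)))"
  by (simp add: Kvf_def fun_eq_iff)

lemma Kvf_Suc: "Kvf \<alpha> \<beta> (Suc n) = (\<lambda>u. Phi \<alpha> \<beta> u (Kvf \<alpha> \<beta> n u))"
  by (simp add: Kvf_def fun_eq_iff)

lemma poly_field_Kvf_0: "poly_field (Kvf \<alpha> \<beta> 0)"
  unfolding poly_field_def
proof (intro ballI)
  fix u S assume "u \<in> schwartz_fields" "S \<in> schwartz_fields"
  note d = poly_vcurve_displace(1)[OF this, unfolded poly_vcurve_def]
  show "poly_vcurve (\<lambda>e. Kvf \<alpha> \<beta> 0 (displace u e S))"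
    unfolding poly_vcurve_def Kvf_0 fst_conv snd_conv
    by (intro conjI cmult.poly_curve_image(1) d[THEN conjunct1] d[THEN conjunct2])
qed

lemma gateaux_Kvf_0:
  assumes "u \<in> schwartz_fields" "S \<in> schwartz_fields"
  shows "gateaux (Kvf \<alpha> \<beta> 0) u S = ((\<lambda>x. 2 * fst S x), (\<lambda>x. - 2 * snd S x))"
proof -
  note d = poly_vcurve_displace(1)[OF assms, unfolded poly_vcurve_def]
  have v: "velocity (\<lambda>e. fst (displace u e S)) = fst S" "velocity (\<lambda>e. snd (displace u e S)) = snd S"
    using arg_cong[OF poly_vcurve_displace(2)[OF assms], of fst]
      arg_cong[OF poly_vcurve_displace(2)[OF assms], of snd]
    unfolding vvelocity_def fst_conv snd_conv by blast+
  show ?thesis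
    unfolding gateaux_eq_vvelocity vvelocity_def Kvf_0 fst_conv snd_conv
      cmult.poly_curve_image(2)[OF conjunct1[OF d]] cmult.poly_curve_image(2)[OF conjunct2[OF d]] v ..
qed

lemma poly_field_Kvf: "poly_field (Kvf \<alpha> \<beta> n)"
  by (induction n) (auto simp: poly_field_Kvf_0 Kvf_Suc intro: poly_field_Phi)

text \<open>The flow of K_0 is the scaling q -> s q, r -> r / s. \<open>Phi\<close> is equivariant
  under it, because \<open>rho\<close> is invariant and the remaining operators act diagonally on
  the components.\<close>

lemma lie_deriv_op_Kvf_0:
  assumes u: "u \<in> schwartz_fields" and S: "S \<in> schwartz_fields"
  shows "lie_deriv_op (Kvf \<alpha> \<beta> 0) (Phi \<alpha> \<beta>) u S = vzero"
proof -
  define w v where "w = ((\<lambda>x. 2 * fst u x), (\<lambda>x. - 2 * snd u x))"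
    and "v = ((\<lambda>x. 2 * fst S x), (\<lambda>x. - 2 * snd S x))"
  have wv: "w \<in> schwartz_fields" "v \<in> schwartz_fields"
    using u S by (auto simp: w_def v_def schwartz_fields_def intro!: schwartz_cmult schwartz_uminus)
  have fw: "fst w = (\<lambda>x. 2 * fst u x)" "snd w = (\<lambda>x. - 2 * snd u x)" by (simp_all add: w_def)
  have s: "schwartz (fst u)" "schwartz (snd u)" "schwartz (fst S)" "schwartz (snd S)"
    using u S by (auto simp: schwartz_fields_def)
  \<comment> \<open>This is the invariance of \<open>rho\<close> in infinitesimal form.\<close>
  have "rho u v = (\<lambda>x. (- 1) * rho w S x)"
    by (simp add: rho_def v_def w_def fun_eq_iff)
  then have D: "Dinv (rho u v) x = - Dinv (rho w S) x" for x
    by (simp only: Dinv_cmult)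
  \<comment> \<open>Both rows at once: (b, c) is (1/2, 2) in the first and (-1/2, -2) in the second,
    and \<open>d\<close> stands for the derivative of the component of \<open>S\<close>.\<close>
  have L: "- Lop a \<beta> (\<lambda>x. c * p x * Dinv (rho u S) x + p x * Dinv (rho w S) x) x
      - c * (b * d - Lop a \<beta> (\<lambda>x. p x * Dinv (rho u S) x) x)
      + (b * (c * d) - Lop a \<beta> (\<lambda>x. p x * Dinv (rho u v) x) x) = 0"
    if p: "schwartz p" for a b p c d x
  proof -
    have m: "schwartz (\<lambda>x. p x * Dinv (rho u S) x)" "schwartz (\<lambda>x. p x * Dinv (rho w S) x)"
      by (intro sc p rho_schwartz u S wv)+
    have "Lop a \<beta> (\<lambda>x. c * p x * Dinv (rho u S) x + p x * Dinv (rho w S) x) x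
        = c * Lop a \<beta> (\<lambda>x. p x * Dinv (rho u S) x) x + Lop a \<beta> (\<lambda>x. p x * Dinv (rho w S) x) x"
      unfolding mult.assoc Lop.add[OF schwartz_cmult[OF m(1)] m(2)] Lop.cmult[OF m(1)] ..
    moreover have "Lop a \<beta> (\<lambda>x. p x * Dinv (rho u v) x) x = - Lop a \<beta> (\<lambda>x. p x * Dinv (rho w S) x) x"
      using Lop.cmult[OF m(2), of a \<beta> "-1"] by (simp add: D)
    ultimately show ?thesis by (simp add: algebra_simps)
  qed
  have PS: "Phi \<alpha> \<beta> u S \<in> schwartz_fields" by (intro Phi_schwartz u S)
  have dv: "deriv (fst v) x = 2 * deriv (fst S) x" "deriv (snd v) x = - 2 * deriv (snd S) x" for x
    unfolding v_def fst_conv snd_conv by (intro deriv.cmult s)+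
  show ?thesis
    unfolding lie_deriv_op_Phi[OF poly_field_Kvf_0 u S] gateaux_Kvf_0[OF u S] gateaux_Kvf_0[OF u PS]
      v_def[symmetric]
    unfolding Kvf_0 w_def[symmetric] Phi_Lop[OF u S] Phi_Lop[OF u wv(2)] dPhi_def vadd_def vsub_def
      fst_conv snd_conv dv vzero_def fw L[OF s(1)] L[OF s(2)] ..
qed

lemma lie_deriv_op_Kvf:
  assumes u: "u \<in> schwartz_fields" and S: "S \<in> schwartz_fields"
  shows "lie_deriv_op (Kvf \<alpha> \<beta> n) (Phi \<alpha> \<beta>) u S = vzero"
  by (induction n)
     (simp_all add: Kvf_Suc lie_deriv_op_Kvf_0 lie_deriv_op_Phi_Phi poly_field_Kvf Phi_vzero assms)

text \<open>By the product rule, [K, Phi Y] - Phi [K, Y] is minus the Lie derivative of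
  \<open>Phi\<close> along \<open>K\<close> applied to \<open>Y\<close>.\<close>

lemma lie_bracket_Phi:
  assumes K: "poly_field K" and Y: "poly_field Y" and u: "u \<in> schwartz_fields"
    and L: "lie_deriv_op K (Phi \<alpha> \<beta>) u (Y u) = vzero"
  shows "lie_bracket K (\<lambda>w. Phi \<alpha> \<beta> w (Y w)) u = Phi \<alpha> \<beta> u (lie_bracket K Y u)"
proof -
  note s = poly_field_schwartz[OF K u] poly_field_schwartz[OF Y u]
  note g = gateaux_schwartz[OF K u s(2)] gateaux_schwartz[OF Y u s(1)]
  show ?thesis
    using L unfolding lie_bracket_def lie_deriv_op_Phi[OF K u s(2)] gateaux_Phi[OF Y u s(1)]
      Phi_vsub[OF u g]
    by (simp add: vadd_def vsub_def vzero_def fun_eq_iff) (smt (verit))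
qed

lemma lie_bracket_commute_zero: "lie_bracket K S u = vzero \<Longrightarrow> lie_bracket S K u = vzero"
  by (simp add: lie_bracket_def vsub_def vzero_def fun_eq_iff)

lemma lie_bracket_Kvf:
  assumes u: "u \<in> schwartz_fields"
  shows "lie_bracket (Kvf \<alpha> \<beta> m) (Kvf \<alpha> \<beta> n) u = vzero"
proof -
  have step: "lie_bracket (Kvf \<alpha> \<beta> m) (Kvf \<alpha> \<beta> n) u = vzero"
    if "lie_bracket (Kvf \<alpha> \<beta> m) (Kvf \<alpha> \<beta> 0) u = vzero" for m n
    by (induction n)
       (simp_all add: that Kvf_Suc lie_bracket_Phi poly_field_Kvf lie_deriv_op_Kvf Kvf_schwartz
          Phi_vzero u)
  have "lie_bracket (Kvf \<alpha> \<beta> 0) (Kvf \<alpha> \<beta> 0) u = vzero"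
    by (simp add: lie_bracket_def vsub_self)
  \<comment> \<open>\<open>step\<close> is used twice: [K_0, K_0] = 0 gives [K_0, K_m] = 0, and
    after exchanging the fields [K_m, K_0] = 0 gives [K_m, K_n] = 0.\<close>
  then show ?thesis by (rule step[OF lie_bracket_commute_zero[OF step]])
qed

section \<open>Infinitely many distinct flows\<close>

text \<open>The physicists' Hermite polynomials up to the sign (-1)^n; the recursion is that of the
  polynomial factor in the derivatives of exp(-x^2).\<close>

fun hermite :: "nat \<Rightarrow> real poly" where
  "hermite 0 = 1"
| "hermite (Suc n) = pderiv (hermite n) - [:0, 2:] * hermite n"

text \<open>Multiplication by 2x raises the degree while differentiation lowers it, so the leading
  terms cannot cancel.\<close>

lemma degree_hermite: "degree (hermite n) = n \<and> hermite n \<noteq> 0"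
proof (induction n)
  case (Suc n)
  have d: "degree ([:0, 2:] * hermite n) = Suc n"
    using Suc by (subst degree_mult_eq) auto
  have "degree (pderiv (hermite n)) < Suc n"
    using Suc by (simp add: degree_pderiv)
  then have "degree (hermite (Suc n)) = Suc n"
    by (simp only: hermite.simps diff_conv_add_uminus degree_add_eq_right degree_minus d)
  then show ?case by force
qed simp

definition gauss :: "real \<Rightarrow> real" where
  "gauss x = exp (- x\<^sup>2)"

lemma poly_gauss_has_deriv:
  "((\<lambda>x. poly p x * gauss x) has_real_derivative poly (pderiv p - [:0, 2:] * p) x * gauss x) (at x)"
  unfolding gauss_def
  by (auto intro!: derivative_eq_intros poly_DERIV simp: algebra_simps power2_eq_square)

lemma deriv_pow_gauss: "(deriv ^^ n) gauss = (\<lambda>x. poly (hermite n) x * gauss x)"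
proof (induction n)
  case (Suc n)
  show ?case
    unfolding funpow.simps comp_def Suc hermite.simps
    by (intro ext DERIV_imp_deriv poly_gauss_has_deriv)
qed simp

lemma abs_power_gauss_le: "\<bar>x ^ m * gauss x\<bar> \<le> 1 + real m ^ m"
proof -
  have abs: "\<bar>x ^ m * gauss x\<bar> = \<bar>x\<bar> ^ m * gauss x"
    by (simp add: abs_mult power_abs gauss_def)
  have nonneg: "0 \<le> real m ^ m" by simp
  show ?thesis
  proof (cases "\<bar>x\<bar> \<le> 1 \<or> m = 0")
    case True
    then have "\<bar>x\<bar> ^ m \<le> 1" by (auto intro: power_le_one)
    moreover have "gauss x \<le> 1" by (simp add: gauss_def)
    ultimately have "\<bar>x\<bar> ^ m * gauss x \<le> 1"
      by (intro mult_le_one) (auto simp: gauss_def)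
    with abs nonneg show ?thesis by linarith
  next
    case False
    then have m: "0 < real m" and x: "\<bar>x\<bar> \<le> x\<^sup>2"
      using self_le_power[of "\<bar>x\<bar>" 2] by auto
    \<comment> \<open>The inequality y <= exp y is taken at y = x^2 / m because its m-th power then
      cancels the Gaussian exactly.\<close>
    have "x\<^sup>2 / real m \<le> exp (x\<^sup>2 / real m)"
      using exp_ge_add_one_self[of "x\<^sup>2 / real m"] by linarith
    with m x have "\<bar>x\<bar> \<le> real m * exp (x\<^sup>2 / real m)" by (simp add: field_simps)
    then have "\<bar>x\<bar> ^ m \<le> (real m * exp (x\<^sup>2 / real m)) ^ m"
      by (intro power_mono) auto
    also have "\<dots> = real m ^ m * exp (x\<^sup>2)"
      using m by (simp add: power_mult_distrib exp_of_nat_mult[symmetric])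
    finally have "\<bar>x\<bar> ^ m * gauss x \<le> real m ^ m * exp (x\<^sup>2) * gauss x"
      by (intro mult_right_mono) (auto simp: gauss_def)
    also have "\<dots> = real m ^ m" by (simp add: gauss_def mult.assoc exp_minus)
    finally show ?thesis using abs by linarith
  qed
qed

lemma schwartz_gauss: "schwartz gauss"
  unfolding schwartz_def
proof (intro conjI allI)
  fix k m :: nat and x :: real
  show "(deriv ^^ k) gauss field_differentiable at x"
    unfolding deriv_pow_gauss field_differentiable_def using poly_gauss_has_deriv by blast
  let ?p = "hermite k"
  let ?B = "\<Sum>i\<le>degree ?p. \<bar>coeff ?p i\<bar> * (1 + real (m + i) ^ (m + i))"
  have "\<bar>x ^ m * (deriv ^^ k) gauss x\<bar> \<le> ?B" for x
  proof -
    have "x ^ m * (deriv ^^ k) gauss x = (\<Sum>i\<le>degree ?p. coeff ?p i * (x ^ (m + i) * gauss x))"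
      unfolding deriv_pow_gauss
      by (simp add: poly_altdef sum_distrib_left sum_distrib_right power_add mult_ac)
    also have "\<bar>\<dots>\<bar> \<le> (\<Sum>i\<le>degree ?p. \<bar>coeff ?p i * (x ^ (m + i) * gauss x)\<bar>)"
      by (rule sum_abs)
    also have "\<dots> \<le> ?B"
      unfolding abs_mult[of "coeff _ _"] by (intro sum_mono mult_left_mono abs_power_gauss_le) auto
    finally show ?thesis .
  qed
  then show "bounded (range (\<lambda>x. x ^ m * (deriv ^^ k) gauss x))"
    unfolding bounded_iff by auto
qed

section \<open>Linearization of the hierarchy at the zero field\<close>

lemma Phi_at_vzero:
  assumes "v \<in> schwartz_fields"
  shows "Phi \<alpha> \<beta> vzero v = ((\<lambda>x. 1/2 * deriv (fst v) x), (\<lambda>x. (- 1/2) * deriv (snd v) x))"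
  unfolding Phi_Lop[OF vzero_schwartz assms] by (simp add: vzero_def Lop.zero)

lemma dPhi_at_vzero:
  "w \<in> schwartz_fields \<Longrightarrow> dPhi \<alpha> \<beta> vzero w vzero = vzero"
  by (simp add: dPhi_def vzero_def rho_def[abs_def] Dinv_cmult[of 0, simplified] Lop.zero)

lemma Kvf_at_vzero: "Kvf \<alpha> \<beta> n vzero = vzero"
proof (induction n)
  case 0
  show ?case by (simp add: Kvf_0 vzero_def)
next
  case (Suc n)
  then show ?case by (simp add: Kvf_Suc Phi_vzero vzero_schwartz)
qed

text \<open>At the zero field the nonlocal part of \<open>Phi\<close> and the term from
  \<open>dPhi\<close> vanish, so each step of the hierarchy applies half a derivative to the first
  component.\<close>

lemma gateaux_Kvf_at_vzero:
  assumes S: "S \<in> schwartz_fields"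
  shows "fst (gateaux (Kvf \<alpha> \<beta> n) vzero S) = (\<lambda>x. 2 * (1/2) ^ n * (deriv ^^ n) (fst S) x)"
proof (induction n)
  case 0
  show ?case by (simp add: gateaux_Kvf_0 vzero_schwartz S)
next
  case (Suc n)
  have g: "gateaux (Kvf \<alpha> \<beta> n) vzero S \<in> schwartz_fields"
    by (intro gateaux_schwartz poly_field_Kvf vzero_schwartz S)
  have f: "(deriv ^^ n) (fst S) field_differentiable at x" for x
    using S by (intro schwartz_diff) (simp add: schwartz_fields_def)
  have "gateaux (Kvf \<alpha> \<beta> (Suc n)) vzero S = vadd vzero (Phi \<alpha> \<beta> vzero (gateaux (Kvf \<alpha> \<beta> n) vzero S))"
    unfolding Kvf_Suc gateaux_Phi[OF poly_field_Kvf vzero_schwartz S] Kvf_at_vzero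
      dPhi_at_vzero[OF S] ..
  then show ?case
    unfolding Phi_at_vzero[OF g] Suc by (simp add: vadd_def vzero_def deriv_cmult f)
qed

text \<open>Restrictions are compared because only values on Schwartz fields carry meaning. The
  flows are told apart by their linearizations at zero.\<close>

lemma inj_restrict_Kvf: "inj (\<lambda>n. restrict (Kvf \<alpha> \<beta> n) schwartz_fields)"
proof (rule injI)
  fix m n
  assume eq: "restrict (Kvf \<alpha> \<beta> m) schwartz_fields = restrict (Kvf \<alpha> \<beta> n) schwartz_fields"
  define S :: vfun where "S = (gauss, (\<lambda>x. 0))"
  have S: "S \<in> schwartz_fields" by (simp add: S_def schwartz_fields_def schwartz_gauss schwartz_zero)
  \<comment> \<open>The whole line through zero stays among the Schwartz fields, so equal
    restrictions have equal Gateaux derivatives there.\<close>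
  have "displace vzero e S \<in> schwartz_fields" for e
    using poly_vcurve_schwartz[OF poly_vcurve_displace(1)[OF vzero_schwartz S]] .
  then have "Kvf \<alpha> \<beta> m (displace vzero e S) = Kvf \<alpha> \<beta> n (displace vzero e S)" for e
    using eq by (metis restrict_apply')
  then have "gateaux (Kvf \<alpha> \<beta> m) vzero S = gateaux (Kvf \<alpha> \<beta> n) vzero S"
    by (simp add: gateaux_def)
  then have "(\<lambda>x. 2 * (1/2) ^ m * (deriv ^^ m) gauss x) = (\<lambda>x. 2 * (1/2) ^ n * (deriv ^^ n) gauss x)"
    using gateaux_Kvf_at_vzero[OF S, of \<alpha> \<beta>] by (metis S_def fst_conv)
  \<comment> \<open>The Gaussian is positive and cancels, leaving nonzero multiples of polynomials
    of degrees m and n.\<close>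
  then have "poly (smult ((1/2) ^ m) (hermite m)) x = poly (smult ((1/2) ^ n) (hermite n)) x" for x
    by (auto simp: deriv_pow_gauss fun_eq_iff gauss_def)
  then have "smult ((1/2) ^ m) (hermite m) = smult ((1/2) ^ n) (hermite n)"
    by (intro poly_ext)
  from arg_cong[OF this, of degree] show "m = n" using degree_hermite by simp
qed

section \<open>Assembly of the three claims\<close>

theorem mainTheorem6:
  fixes \<alpha> \<beta> :: real and H :: "nat \<Rightarrow> density"
  assumes dens: "\<And>n. is_density (H n)"
    and H0: "H 0 = (\<lambda>j. j (Qd 0) * j (Rd 0))"
    and grad: "\<And>n u. u \<in> schwartz_fields \<Longrightarrow>
                 var_deriv (H n) u = (Psi \<alpha> \<beta> u ^^ n) (var_deriv (H 0) u)"
  shows "((\<forall>m n. conserved_density (H n) (Kvf \<alpha> \<beta> m)) \<and>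
          (\<forall>m n. \<forall>u\<in>schwartz_fields.
             bracket (opJ \<beta>) (H m) (H n) u = 0 \<and>
             bracket (opM \<alpha>) (H m) (H n) u = 0 \<and>
             bracket (opN \<alpha> \<beta>) (H m) (H n) u = 0))
       \<and> ((\<forall>m n. \<forall>u\<in>schwartz_fields. lie_bracket (Kvf \<alpha> \<beta> m) (Kvf \<alpha> \<beta> n) u = vzero) \<and>
          (\<forall>n. infinite {restrict S schwartz_fields | S.
                  S \<in> range (Kvf \<alpha> \<beta>) \<and> is_symmetry S (Kvf \<alpha> \<beta> n)}))
       \<and> (\<forall>n. recursion_operator (Phi \<alpha> \<beta>) (Kvf \<alpha> \<beta> n))"
proof (intro conjI allI ballI)
  have H: "var_deriv (H n) u = (Psi \<alpha> \<beta> u ^^ n) (snd u, fst u)" if "u \<in> schwartz_fields" for n u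
    using grad[OF that, of n] unfolding H0 var_deriv_qr .
  \<comment> \<open>The Lenard relation makes the \<open>M\<close> bracket of (m, n) the
    \<open>J\<close> bracket of (m, n + 1).\<close>
  have M: "opM \<alpha> u (var_deriv (H n) u) = opJ \<beta> u (var_deriv (H (Suc n)) u)"
    if "u \<in> schwartz_fields" for n u
    unfolding H[OF that] opJ_grad_Suc[OF that] ..
  have J: "bracket (opJ \<beta>) (H m) (H n) u = 0" if "u \<in> schwartz_fields" for m n u
    unfolding bracket_def H[OF that] by (rule pairing_opJ_grad[OF that])
  fix m n
  show "conserved_density (H n) (Kvf \<alpha> \<beta> m)"
    unfolding conserved_density_def
    by (simp add: H Kvf_eq_opJ_grad pairing_opJ_grad)
  show "recursion_operator (Phi \<alpha> \<beta>) (Kvf \<alpha> \<beta> n)"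
    by (simp add: recursion_operator_def lie_deriv_op_Kvf)
  have sym: "is_symmetry (Kvf \<alpha> \<beta> k) (Kvf \<alpha> \<beta> n)" for k
    by (simp add: is_symmetry_def lie_bracket_Kvf)
  \<comment> \<open>Every flow of the hierarchy qualifies as a symmetry, so infinitude reduces to
    injectivity of the restricted flows.\<close>
  have "{restrict S schwartz_fields | S. S \<in> range (Kvf \<alpha> \<beta>) \<and> is_symmetry S (Kvf \<alpha> \<beta> n)}
      = range (\<lambda>k. restrict (Kvf \<alpha> \<beta> k) schwartz_fields)"
    using sym by auto
  then show "infinite {restrict S schwartz_fields | S.
      S \<in> range (Kvf \<alpha> \<beta>) \<and> is_symmetry S (Kvf \<alpha> \<beta> n)}"
    using range_inj_infinite[OF inj_restrict_Kvf] by simp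
  fix u assume u: "u \<in> schwartz_fields"
  show "bracket (opJ \<beta>) (H m) (H n) u = 0" by (rule J[OF u])
  show "bracket (opM \<alpha>) (H m) (H n) u = 0"
    unfolding bracket_def M[OF u] by (rule J[OF u, unfolded bracket_def])
  \<comment> \<open>As N = M Psi, two index shifts make the \<open>N\<close> bracket of (m, n) the
    \<open>J\<close> bracket of (m, n + 2).\<close>
  have "Psi \<alpha> \<beta> u (var_deriv (H n) u) = var_deriv (H (Suc n)) u"
    by (simp add: H[OF u])
  then show "bracket (opN \<alpha> \<beta>) (H m) (H n) u = 0"
    unfolding bracket_def opN_def comp_def by (simp only: M[OF u] J[OF u, unfolded bracket_def])
  show "lie_bracket (Kvf \<alpha> \<beta> m) (Kvf \<alpha> \<beta> n) u = vzero" by (rule lie_bracket_Kvf[OF u])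
qed

end
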